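(* Let $a\neq 0$ and $b$ be fixed integers, and let $S$ be a nondegenerate Lucas sequence $U(P,Q)$ or $V(P,Q)$ with $P\in\mathbb{Z}$ and $Q=\pm1$. Unless $S$ is $V(P,Q)$ and $b=\pm 2$, finding the terms of $S$ of the form $am^2+b$ with $m\in\mathbb{Z}$ (i.e. finding all integers $m$ such that $am^2+b$ is a term of $S$) reduces to solving a finite number of Thue equations.
   Context: For $P,Q\in\mathbb{Z}$ the Lucas sequences $U(P,Q)=(U_n)_{n\ge0}$ and $V(P,Q)=(V_n)_{n\ge 0}$ are defined by $U_0=0$, $U_1=1$, $U_{n+1}=P U_n-Q U_{n-1}$ and $V_0=2$, $V_1=P$, $V_{n+1}=P V_n-Q V_{n-1}$ for $n\ge1$. Their discriminant is $D=P^2-4Q$. For nondegenerate sequences, $D$ is a positive non-square integer. A Thue equation here is an equation $g(m,n)=d$ in integer unknowns $m,n$, where $d$ is a non-zero integer and $g\in\mathbb{Z}[m,n]$ is a homogeneous polynomial of degree at least $3$ (in fact quartic in this setting). Normally $g$ is required to be irreducible; by convention, the lists of equations produced by a reduction may also include "Thue-like" quartic equations in which $g$ is reducible, provided $g$ is not of the form $\kappa\cdot T(m,n)^2$ with $\kappa$ a constant and $T$ a polynomial (so that the equation still has only finitely many integer solutions). "Finding the solutions of a problem reduces to solving a finite number of Thue equations" means: there is an algorithm which, from the data of the problem (here $a,b,P,Q$ and the choice of $U$ or $V$), produces a finite (possibly empty) list of equations $g(m,n)=d$ in integer unknowns $m,n$, each with $d$ a non-zero integer and $g\in\mathbb{Z}[m,n]$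 a homogeneous polynomial that is either irreducible of degree at least $3$, or reducible of degree $4$ but not of the form $\kappa\cdot T(m,n)^2$ with $\kappa$ a constant and $T$ a polynomial, together with an explicit computable rule assigning to each integer solution of each equation in the list a finite set of candidates, such that every solution of the problem (here, every integer $m$ with $am^2+b$ a term of $S$) occurs among the candidates so obtained. *)

theory Defs
  imports
    "HOL-Computational_Algebra.Computational_Algebra"
    "HOL-Library.Nat_Bijection"
begin

section \<open>Lucas sequences\<close>

fun lucas_U :: "int \<Rightarrow> int \<Rightarrow> nat \<Rightarrow> int" where
  "lucas_U P Q 0 = 0"
| "lucas_U P Q (Suc 0) = 1"
| "lucas_U P Q (Suc (Suc n)) = P * lucas_U P Q (Suc n) - Q * lucas_U P Q n"

fun lucas_V :: "int \<Rightarrow> int \<Rightarrow> nat \<Rightarrow> int" where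
  "lucas_V P Q 0 = 2"
| "lucas_V P Q (Suc 0) = P"
| "lucas_V P Q (Suc (Suc n)) = P * lucas_V P Q (Suc n) - Q * lucas_V P Q n"

datatype lucas_kind = LucasU | LucasV

fun lucas :: "lucas_kind \<Rightarrow> int \<Rightarrow> int \<Rightarrow> nat \<Rightarrow> int" where
  "lucas LucasU P Q n = lucas_U P Q n"
| "lucas LucasV P Q n = lucas_V P Q n"

definition lucas_discr :: "int \<Rightarrow> int \<Rightarrow> int" where
  "lucas_discr P Q = P\<^sup>2 - 4 * Q"

text \<open>This is meant for \<^term>\<open>Q = 1\<close> and \<^term>\<open>Q = -1\<close>, where it agrees with the usual
  requirement that the quotient of the two characteristic roots is not a root of unity;
  see \<open>nondegenerate_iff\<close> below.\<close>

definition nondegenerate :: "int \<Rightarrow> int \<Rightarrow> bool" where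
  "nondegenerate P Q \<longleftrightarrow> lucas_discr P Q > 0 \<and> \<not> is_square (lucas_discr P Q)"

lemma nondegenerate_iff:
  assumes Q: "Q = 1 \<or> Q = -1"
  shows "nondegenerate P Q \<longleftrightarrow>
    (\<forall>\<alpha> \<beta> :: complex. \<alpha> + \<beta> = of_int P \<and> \<alpha> * \<beta> = of_int Q \<longrightarrow> (\<forall>n>0. \<alpha> ^ n \<noteq> \<beta> ^ n))"
proof
  assume nd: "nondegenerate P Q"
  show "\<forall>\<alpha> \<beta> :: complex. \<alpha> + \<beta> = of_int P \<and> \<alpha> * \<beta> = of_int Q \<longrightarrow> (\<forall>n>0. \<alpha> ^ n \<noteq> \<beta> ^ n)"
  proof (intro allI impI notI)
    fix \<alpha> \<beta> :: complex and n :: nat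
    assume ab: "\<alpha> + \<beta> = of_int P \<and> \<alpha> * \<beta> = of_int Q" and n: "n > 0" and eq: "\<alpha> ^ n = \<beta> ^ n"
    define D where "D = lucas_discr P Q"
    have D: "D > 0" "\<not> is_square D" using nd by (auto simp: nondegenerate_def D_def)
    have P: "P \<noteq> 0"
    proof
      assume "P = 0"
      with Q D(1) have "D = 2\<^sup>2" by (auto simp: D_def lucas_discr_def)
      with D(2) show False by (metis is_nth_power_nth_power)
    qed
    have "(\<alpha> - \<beta>)\<^sup>2 = (\<alpha> + \<beta>)\<^sup>2 - 4 * (\<alpha> * \<beta>)" by (simp add: power2_eq_square algebra_simps)
    also have "\<dots> = of_real (of_int D)"
      using ab by (simp add: D_def lucas_discr_def)
    also have "\<dots> = of_real ((sqrt (of_int D))\<^sup>2)"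
      using D(1) by (subst real_sqrt_pow2) auto
    also have "\<dots> = of_real (sqrt (of_int D)) ^ 2"
      by (rule of_real_power)
    finally have "\<alpha> - \<beta> = of_real (sqrt (of_int D)) \<or> \<alpha> - \<beta> = of_real (- sqrt (of_int D))"
      by (simp add: power2_eq_iff)
    then obtain r where r: "\<alpha> - \<beta> = of_real r" "r \<noteq> 0" using D(1) by force
    have "\<alpha> = ((\<alpha> + \<beta>) + (\<alpha> - \<beta>)) / 2" by simp
    hence a: "\<alpha> = of_real ((of_int P + r) / 2)" using ab r by simp
    have "\<beta> = ((\<alpha> + \<beta>) - (\<alpha> - \<beta>)) / 2" by simp
    hence b: "\<beta> = of_real ((of_int P - r) / 2)" using ab r by simp
    have "norm \<alpha> ^ n = norm \<beta> ^ n" using eq by (metis norm_power)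
    hence "norm \<alpha> = norm \<beta>" using power_eq_imp_eq_base[of "norm \<alpha>" n "norm \<beta>"] n by simp
    hence "\<bar>(of_int P + r) / 2\<bar> = \<bar>(of_int P - r) / 2\<bar>" unfolding a b norm_of_real .
    hence "r = 0 \<or> real_of_int P = 0" unfolding abs_eq_iff by (auto simp: field_simps)
    thus False using P r(2) by simp
  qed
next
  assume *: "\<forall>\<alpha> \<beta> :: complex. \<alpha> + \<beta> = of_int P \<and> \<alpha> * \<beta> = of_int Q \<longrightarrow> (\<forall>n>0. \<alpha> ^ n \<noteq> \<beta> ^ n)"
  have no_sq: "\<not> is_square N" if "m\<^sup>2 < N" "N < (m + 1)\<^sup>2" "m \<ge> 0" for m N :: int
  proof
    assume "is_square N"
    then obtain k where "N = k\<^sup>2" by (auto elim: is_nth_powerE)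
    hence "m\<^sup>2 < \<bar>k\<bar>\<^sup>2" "\<bar>k\<bar>\<^sup>2 < (m + 1)\<^sup>2" using that by simp_all
    hence "m < \<bar>k\<bar>" "\<bar>k\<bar> < m + 1" 
      using \<open>m \<ge> 0\<close> power_less_imp_less_base[of m 2 "\<bar>k\<bar>"]
        power_less_imp_less_base[of "\<bar>k\<bar>" 2 "m + 1"] by linarith+
    thus False by simp
  qed
  show "nondegenerate P Q"
  proof (rule ccontr)
    assume deg: "\<not> nondegenerate P Q"
    have small: "Q = 1 \<and> P \<in> {-2, -1, 0, 1, 2} \<or> Q = -1 \<and> P = 0"
    proof (cases "Q = 1")
      case True
      have "\<bar>P\<bar> \<le> 2"
      proof (rule ccontr)
        assume "\<not> \<bar>P\<bar> \<le> 2"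
        hence P3: "\<bar>P\<bar> \<ge> 3" by simp
        hence "\<bar>P\<bar> * \<bar>P\<bar> \<ge> 3 * 3" by (intro mult_mono) auto
        hence "P\<^sup>2 \<ge> 9" by (simp add: power2_eq_square)
        moreover have "\<not> is_square (P\<^sup>2 - 4)"
        proof (rule no_sq[of "\<bar>P\<bar> - 1"])
          have "(\<bar>P\<bar> - 1)\<^sup>2 = P\<^sup>2 - 2 * \<bar>P\<bar> + 1" by (simp add: power2_eq_square algebra_simps)
          thus "(\<bar>P\<bar> - 1)\<^sup>2 < P\<^sup>2 - 4" using P3 by simp
        qed (use P3 in auto)
        ultimately show False using deg True by (simp add: nondegenerate_def lucas_discr_def)
      qed
      thus ?thesis using True by auto
    next
      case False
      hence Q1: "Q = -1" using Q by simp
      have "P = 0"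
      proof (rule ccontr)
        assume "P \<noteq> 0"
        hence P1: "\<bar>P\<bar> \<ge> 1" by simp
        have "\<not> is_square (P\<^sup>2 + 4)"
        proof
          assume "is_square (P\<^sup>2 + 4)"
          then obtain k where "P\<^sup>2 + 4 = k\<^sup>2" by (auto elim: is_nth_powerE)
          hence k: "\<bar>k\<bar>\<^sup>2 = \<bar>P\<bar>\<^sup>2 + 4" by simp
          have "\<bar>P\<bar>\<^sup>2 < \<bar>k\<bar>\<^sup>2" using k by simp
          hence "\<bar>P\<bar> < \<bar>k\<bar>" by (rule power_less_imp_less_base) simp
          moreover have "(\<bar>P\<bar> + 2)\<^sup>2 = \<bar>P\<bar>\<^sup>2 + 4 * \<bar>P\<bar> + 4"
            by (simp add: power2_eq_square algebra_simps)
          hence "\<bar>k\<bar>\<^sup>2 < (\<bar>P\<bar> + 2)\<^sup>2" using k P1 by simp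
          hence "\<bar>k\<bar> < \<bar>P\<bar> + 2" by (rule power_less_imp_less_base) simp
          ultimately have "\<bar>k\<bar> = \<bar>P\<bar> + 1" by simp
          hence "(\<bar>P\<bar> + 1)\<^sup>2 = \<bar>P\<bar>\<^sup>2 + 4" using k by simp
          moreover have "(\<bar>P\<bar> + 1)\<^sup>2 = \<bar>P\<bar>\<^sup>2 + 2 * \<bar>P\<bar> + 1"
            by (simp add: power2_eq_square algebra_simps)
          ultimately show False by presburger
        qed
        moreover have "P\<^sup>2 + 4 > 0" by (simp add: add_nonneg_pos)
        ultimately show False using deg Q1 by (simp add: nondegenerate_def lucas_discr_def)
      qed
      thus ?thesis using Q1 by simp
    qed
    have root: "z ^ 12 = 1" if z: "z\<^sup>2 = of_int P * z - of_int Q" for z :: complex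
    proof -
      have e: "z ^ 12 = (z\<^sup>2) ^ 6" "z ^ 12 = (z ^ 3) ^ 4"
        by (simp_all only: power_mult[symmetric]) simp_all
      have cube: "z ^ 3 = z * z\<^sup>2" by (simp add: power3_eq_cube power2_eq_square)
      consider "Q = 1" "P = -2" | "Q = 1" "P = -1" | "Q = 1" "P = 0" | "Q = 1" "P = 1"
        | "Q = 1" "P = 2" | "Q = -1" "P = 0" using small by auto
      thus ?thesis
      proof cases
        case 1
        hence "z\<^sup>2 = - 2 * z - 1" using z by simp
        hence "(z + 1)\<^sup>2 = 0" unfolding power2_sum by simp
        hence "z = -1" by (simp add: eq_neg_iff_add_eq_0)
        thus ?thesis by simp
      next
        case 2
        hence q: "z\<^sup>2 = - z - 1" using z by simp
        have "z ^ 3 = - (z * z) - z" unfolding cube q by (simp add: algebra_simps)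
        also have "\<dots> = 1" unfolding power2_eq_square[symmetric] q by simp
        finally show ?thesis using e(2) by simp
      next
        case 3
        hence "z\<^sup>2 = -1" using z by simp
        thus ?thesis using e(1) by simp
      next
        case 4
        hence q: "z\<^sup>2 = z - 1" using z by simp
        have "z ^ 3 = z * z - z" unfolding cube q by (simp add: algebra_simps)
        also have "\<dots> = -1" unfolding power2_eq_square[symmetric] q by simp
        finally show ?thesis using e(2) by simp
      next
        case 5
        hence "z\<^sup>2 = 2 * z - 1" using z by simp
        hence "(z - 1)\<^sup>2 = 0" unfolding power2_diff by simp
        thus ?thesis by simp
      next
        case 6
        hence "z\<^sup>2 = 1" using z by simp
        thus ?thesis using e(1) by simp
      qed
    qed
    define s where "s = csqrt (of_int (lucas_discr P Q))"
    define \<alpha> \<beta> where "\<alpha> = (of_int P + s) / 2" and "\<beta> = (of_int P - s) / 2"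
    have s: "s\<^sup>2 = of_int P ^ 2 - 4 * of_int Q" by (simp add: s_def lucas_discr_def)
    have sum: "\<alpha> + \<beta> = of_int P" by (simp add: \<alpha>_def \<beta>_def field_simps)
    have "4 * (\<alpha> * \<beta>) = of_int P ^ 2 - s\<^sup>2"
      by (simp add: \<alpha>_def \<beta>_def power2_eq_square field_simps)
    hence prod: "\<alpha> * \<beta> = of_int Q" using s by simp
    have "\<alpha>\<^sup>2 = of_int P * \<alpha> - of_int Q" "\<beta>\<^sup>2 = of_int P * \<beta> - of_int Q"
      unfolding sum[symmetric] prod[symmetric] by (simp_all add: power2_eq_square algebra_simps)
    hence "\<alpha> ^ 12 = \<beta> ^ 12" by (simp add: root)
    moreover have "\<alpha> ^ 12 \<noteq> \<beta> ^ 12" using * sum prod by simp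
    ultimately show False by contradiction
  qed
qed


section \<open>Computable functions\<close>

text \<open>\<open>recursive n f\<close>: \<open>f\<close>, restricted to lists of length \<open>n\<close>, is a total recursive function of
  arity \<open>n\<close>. The value of \<open>f\<close> on lists of other lengths carries no meaning.\<close>

inductive recursive :: "nat \<Rightarrow> (nat list \<Rightarrow> nat) \<Rightarrow> bool" where
  zero: "recursive n (\<lambda>xs. 0)"
| succ: "recursive 1 (\<lambda>xs. Suc (xs ! 0))"
| proj: "i < n \<Longrightarrow> recursive n (\<lambda>xs. xs ! i)"
| comp: "recursive (length gs) f \<Longrightarrow> \<forall>g\<in>set gs. recursive n g \<Longrightarrow>
    recursive n (\<lambda>xs. f (map (\<lambda>g. g xs) gs))"
| prim: "recursive n f \<Longrightarrow> recursive (n + 2) g \<Longrightarrow>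
    recursive (n + 1) (\<lambda>xs. rec_nat (f (tl xs)) (\<lambda>k r. g (k # r # tl xs)) (hd xs))"
| mu: "recursive (n + 1) f \<Longrightarrow> \<forall>xs. length xs = n \<longrightarrow> (\<exists>k. f (k # xs) = 0) \<Longrightarrow>
    recursive n (\<lambda>xs. LEAST k. f (k # xs) = 0)"

text \<open>Inputs and outputs of algorithms are represented by natural numbers. An object may have
  several codes, e.g.\ a polynomial may be given by a coefficient list with trailing zeros;
  \<open>encode\<close> picks one of them.\<close>

class coded =
  fixes encode :: "'a \<Rightarrow> nat"
    and decode :: "nat \<Rightarrow> 'a"
  assumes decode_encode: "decode (encode x) = x"

instantiation nat :: coded
begin
definition "encode_nat (n::nat) = n"
definition "decode_nat (n::nat) = n"
instance by standard (simp add: encode_nat_def decode_nat_def)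
end

instantiation int :: coded
begin
definition "encode_int = int_encode"
definition "decode_int = int_decode"
instance by standard (simp add: encode_int_def decode_int_def)
end

instantiation lucas_kind :: coded
begin
definition "encode_lucas_kind S = (case S of LucasU \<Rightarrow> (0::nat) | LucasV \<Rightarrow> 1)"
definition "decode_lucas_kind (n::nat) = (if n = 0 then LucasU else LucasV)"
instance
  by standard (simp add: encode_lucas_kind_def decode_lucas_kind_def split: lucas_kind.split)
end

instantiation prod :: (coded, coded) coded
begin
definition "encode_prod z = prod_encode (encode (fst z), encode (snd z))"
definition "decode_prod n = (decode (fst (prod_decode n)), decode (snd (prod_decode n)))"
instance by standard (simp add: encode_prod_def decode_prod_def decode_encode)
end

instantiation list :: (coded) coded
begin
definition "encode_list xs = list_encode (map encode xs)"
definition "decode_list n = map decode (list_decode n)"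
instance by standard (simp add: encode_list_def decode_list_def decode_encode comp_def)
end

instantiation poly :: ("{coded, zero}") coded
begin
definition "encode_poly p = encode (coeffs p)"
definition "decode_poly n = Poly (decode n)"
instance by standard (simp add: encode_poly_def decode_poly_def decode_encode)
end

definition computable :: "('a::coded \<Rightarrow> 'b::coded) \<Rightarrow> bool" where
  "computable f \<longleftrightarrow> (\<exists>r. recursive 1 r \<and> (\<forall>x. f x = decode (r [encode x])))"


section \<open>Thue equations\<close>

text \<open>An element \<open>g\<close> of \<open>\<int>[m,n]\<close> is a polynomial in \<open>m\<close> with coefficients in \<open>\<int>[n]\<close>.\<close>

definition eval2 :: "int poly poly \<Rightarrow> int \<Rightarrow> int \<Rightarrow> int" where
  "eval2 g m n = poly (poly g [:m:]) n"

definition homogeneous :: "nat \<Rightarrow> int poly poly \<Rightarrow> bool" where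
  "homogeneous k g \<longleftrightarrow> g \<noteq> 0 \<and> (\<forall>i j. coeff (coeff g i) j \<noteq> 0 \<longrightarrow> i + j = k)"

text \<open>The constant and the polynomial may be complex, so this excludes the most forms;
  by Gauss's lemma it makes no difference to restrict them to the integers.\<close>

definition const_times_square :: "int poly poly \<Rightarrow> bool" where
  "const_times_square g \<longleftrightarrow>
    (\<exists>(\<kappa>::complex) T. map_poly (map_poly of_int) g = smult [:\<kappa>:] (T\<^sup>2))"

text \<open>The pair \<open>(g, d)\<close> stands for the equation \<open>g(m,n) = d\<close>.\<close>

definition thue_equation :: "int poly poly \<times> int \<Rightarrow> bool" where
  "thue_equation = (\<lambda>(g, d). d \<noteq> 0 \<and>
    (\<exists>k. homogeneous k g \<and>
      (irreducible g \<and> k \<ge> 3 \<or>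
       \<not> irreducible g \<and> k = 4 \<and> \<not> const_times_square g)))"

definition solves :: "int \<times> int \<Rightarrow> int poly poly \<times> int \<Rightarrow> bool" where
  "solves = (\<lambda>(m, n) (g, d). eval2 g m n = d)"

text \<open>\<open>sols p\<close> is the set of solutions of the problem with data \<open>p\<close>, and \<open>I\<close> is the set of admissible
  data. Both algorithms are uniform in the data: \<open>eqs p\<close> is the list of equations, and
  \<open>cand (p, i, z)\<close> lists the candidates obtained from the solution \<open>z\<close> of the \<open>i\<close>-th equation.\<close>

definition reduces_to_thue :: "'p::coded set \<Rightarrow> ('p \<Rightarrow> int set) \<Rightarrow> bool" where
  "reduces_to_thue I sols \<longleftrightarrow>
    (\<exists>(eqs :: 'p \<Rightarrow> (int poly poly \<times> int) list) (cand :: 'p \<times> nat \<times> (int \<times> int) \<Rightarrow> int list).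
      computable eqs \<and> computable cand \<and>
      (\<forall>p\<in>I. (\<forall>e\<in>set (eqs p). thue_equation e) \<and>
        (\<forall>s\<in>sols p. \<exists>i<length (eqs p). \<exists>z. solves z (eqs p ! i) \<and> s \<in> set (cand (p, i, z)))))"

end

theory Submission
  imports Defs
begin

text \<open>Write $n = 2k + r$ with $r \in \{0, 1\}$ and put $x = V_k$, $y = U_k$. The doubling formulas express
$4 U_n$ and $4 V_n$ as binary quadratic forms in $x$ and $y$, and $x^2 - D y^2 = 4 Q^k = \pm 4$ with
$D = P^2 - 4 Q$ turns the constant $4 b$ into a form too. So $a m^2 + b = U_n$ (or $V_n$) says that
$(x, y, m)$ lies on one of finitely many conics $A x^2 + B x y + C y^2 = 4 a m^2$ that depend only on
the data (\<open>lucas_term_conic\<close>). These conics are nondegenerate; only for $V$ with $b = \pm 2$ would a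
degenerate one occur.

A conic with one rational point has a zero of explicitly bounded size. This is Cassels' argument:
a zero that is too large is reflected, by means of a good simultaneous rational approximation, into
a smaller one (\<open>small_zero\<close>). Projecting from a small zero parametrises the conic by two binary
quadratic forms $R_1, R_2$ with bounded coefficients: every solution that is not
proportional to the small zero satisfies
$4 R_1(s,t) = M x$ and $4 R_2(s,t) = M y$ with integers $s, t$ and a factor $M$ dividing a bounded
non-zero integer (\<open>conic_parametrisation\<close>). Substituting into $x^2 - D y^2 = \pm 4$ gives the quartic
equation $R_1(s,t)^2 - D R_2(s,t)^2 = d$ with $4 d = \pm M^2$, in which $d$ takes finitely many values.

The quartic is not a constant times a square: its zeros are the preimages of the two points
$x = \pm y \sqrt D$ of the projective line under the double covering by the conic, and these
are not branch points (\<open>par_quartic_not_square\<close>). A quartic form that is not a constant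
times a square is admissible whether or not it is irreducible.

The algorithm uses only the bounds. Since all coefficients are bounded by an explicit power of
the code of the data, the list can consist of all quartic equations below that bound
which pass a polynomial test for not being a constant times a square. Likewise $m$ is
bounded by an explicit function of the data and of $(s,t)$, so the candidates are all
integers up to this bound (\<open>conic_descent\<close>). What remains is to see that these two enumerations
are recursive.\<close>

section \<open>Recursive functions of natural numbers\<close>

text \<open>The values of a recursive function on lists of the wrong length carry no meaning, but the
inductive rules fix them. Ignoring those values makes the class closed under all the usual
constructions, in particular under replacing a list by the list of its entries.\<close>

definition rec_fun :: "nat \<Rightarrow> (nat list \<Rightarrow> nat) \<Rightarrow> bool" where
  "rec_fun n f \<longleftrightarrow> (\<exists>r. recursive n r \<and> (\<forall>xs. length xs = n \<longrightarrow> r xs = f xs))"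

lemma rec_fun_cong:
  assumes "rec_fun n f" and "\<And>xs. length xs = n \<Longrightarrow> f xs = g xs"
  shows "rec_fun n g"
  using assms unfolding rec_fun_def by metis

lemma rec_fun_0: "rec_fun n (\<lambda>xs. 0)"
  unfolding rec_fun_def using recursive.zero by blast

lemma rec_fun_nth: "i < n \<Longrightarrow> rec_fun n (\<lambda>xs. xs ! i)"
  unfolding rec_fun_def using recursive.proj by blast

lemma rec_fun_comp:
  assumes f: "rec_fun (length gs) f" and gs: "\<And>g. g \<in> set gs \<Longrightarrow> rec_fun n g"
  shows "rec_fun n (\<lambda>xs. f (map (\<lambda>g. g xs) gs))"
proof -
  obtain r where r: "recursive (length gs) r" "\<And>xs. length xs = length gs \<Longrightarrow> r xs = f xs"
    using f unfolding rec_fun_def by blast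
  obtain R where R: "\<And>g. g \<in> set gs \<Longrightarrow> recursive n (R g)"
    "\<And>g xs. g \<in> set gs \<Longrightarrow> length xs = n \<Longrightarrow> R g xs = g xs"
    using gs unfolding rec_fun_def by metis
  have "recursive n (\<lambda>xs. r (map (\<lambda>g. g xs) (map R gs)))"
    using r(1) R(1) by (intro recursive.comp) auto
  moreover have "r (map (\<lambda>g. g xs) (map R gs)) = f (map (\<lambda>g. g xs) gs)" if "length xs = n" for xs
  proof -
    have "map (\<lambda>g. g xs) (map R gs) = map (\<lambda>g. g xs) gs"
      using R(2)[OF _ that] by simp
    thus ?thesis unfolding \<open>map (\<lambda>g. g xs) (map R gs) = map (\<lambda>g. g xs) gs\<close> by (intro r(2)) simp
  qed
  ultimately show ?thesis unfolding rec_fun_def by blast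
qed

lemma rec_fun_comp1:
  assumes "rec_fun 1 (\<lambda>xs. h (xs ! 0))" "rec_fun n f"
  shows "rec_fun n (\<lambda>xs. h (f xs))"
  using rec_fun_comp[of "[f]" "\<lambda>xs. h (xs ! 0)" n] assms by simp

lemma rec_fun_comp2:
  assumes "rec_fun 2 (\<lambda>xs. h (xs ! 0) (xs ! 1))" "rec_fun n f" "rec_fun n g"
  shows "rec_fun n (\<lambda>xs. h (f xs) (g xs))"
  using rec_fun_comp[of "[f, g]" "\<lambda>xs. h (xs ! 0) (xs ! 1)" n] assms by (auto simp: numeral_2_eq_2)

lemma rec_fun_Suc: "rec_fun n f \<Longrightarrow> rec_fun n (\<lambda>xs. Suc (f xs))"
  by (rule rec_fun_comp1[where h = Suc]) (use recursive.succ in \<open>auto simp: rec_fun_def\<close>)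

lemma rec_fun_const: "rec_fun n (\<lambda>xs. c)"
  by (induction c) (auto intro: rec_fun_0 rec_fun_Suc)

text \<open>Primitive recursion with the parameters kept in place. The inductive rule expects the recursion
argument at the head of the list, so it is composed with the list whose head is \<open>h xs\<close> and whose tail
consists of the projections of \<open>xs\<close>.\<close>

lemma rec_fun_rec_nat:
  assumes f: "rec_fun n f" and h: "rec_fun n h"
    and g: "rec_fun (n + 2) (\<lambda>xs. g (xs ! 0) (xs ! 1) (drop 2 xs))"
  shows "rec_fun n (\<lambda>xs. rec_nat (f xs) (\<lambda>k r. g k r xs) (h xs))"
proof -
  obtain F where F: "recursive n F" "\<And>xs. length xs = n \<Longrightarrow> F xs = f xs"
    using f unfolding rec_fun_def by blast
  obtain G where G: "recursive (n + 2) G"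
    "\<And>xs. length xs = n + 2 \<Longrightarrow> G xs = g (xs ! 0) (xs ! 1) (drop 2 xs)"
    using g unfolding rec_fun_def by blast
  let ?r = "\<lambda>xs. rec_nat (F (tl xs)) (\<lambda>k r. G (k # r # tl xs)) (hd xs)"
  let ?gs = "h # map (\<lambda>i xs. xs ! i) [0..<n]"
  have "rec_fun (length ?gs) ?r"
    using recursive.prim[OF F(1) G(1)] unfolding rec_fun_def by auto
  hence "rec_fun n (\<lambda>xs. ?r (map (\<lambda>g. g xs) ?gs))"
    by (rule rec_fun_comp) (use h in \<open>auto intro: rec_fun_nth\<close>)
  thus ?thesis
  proof (rule rec_fun_cong)
    fix xs :: "nat list" assume n: "length xs = n"
    have "map (\<lambda>g. g xs) (map (\<lambda>i xs. xs ! i) [0..<n]) = xs"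
      using n by (auto simp: comp_def map_nth intro: nth_equalityI)
    thus "?r (map (\<lambda>g. g xs) ?gs) = rec_nat (f xs) (\<lambda>k r. g k r xs) (h xs)"
      by (simp add: F(2) G(2) n)
  qed
qed

lemma rec_fun_LEAST:
  assumes f: "rec_fun (Suc n) (\<lambda>xs. f (xs ! 0) (tl xs))"
    and ex: "\<And>xs. length xs = n \<Longrightarrow> \<exists>k. f k xs = 0"
  shows "rec_fun n (\<lambda>xs. LEAST k. f k xs = 0)"
proof -
  obtain F where F: "recursive (n + 1) F" "\<And>xs. length xs = Suc n \<Longrightarrow> F xs = f (xs ! 0) (tl xs)"
    using f unfolding rec_fun_def by auto
  have "recursive n (\<lambda>xs. LEAST k. F (k # xs) = 0)"
    using F(1) by (rule recursive.mu) (simp add: F(2) ex)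
  thus ?thesis unfolding rec_fun_def by (auto simp: F(2))
qed

lemma rec_fun_nth_tl: "Suc i < n \<Longrightarrow> rec_fun n (\<lambda>xs. tl xs ! i)"
  by (rule rec_fun_cong[OF rec_fun_nth[of "Suc i"]]) (auto simp: nth_tl)

lemma rec_fun_nth_drop: "j + i < n \<Longrightarrow> rec_fun n (\<lambda>xs. drop j xs ! i)"
  by (rule rec_fun_cong[OF rec_fun_nth[of "j + i"]]) (auto simp: nth_drop)

lemma rec_fun_add:
  assumes "rec_fun n f" "rec_fun n g"
  shows "rec_fun n (\<lambda>xs. f xs + g xs)"
proof (rule rec_fun_comp2[OF _ assms])
  have "rec_fun 2 (\<lambda>xs. rec_nat (xs ! 0) (\<lambda>k r. Suc r) (xs ! 1))"
    by (intro rec_fun_rec_nat rec_fun_Suc rec_fun_nth) simp_all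
  moreover have "rec_nat x (\<lambda>k r. Suc r) y = x + y" for x y :: nat by (induction y) auto
  ultimately show "rec_fun 2 (\<lambda>xs. xs ! 0 + xs ! 1)" by simp
qed

lemma rec_fun_mult:
  assumes "rec_fun n f" "rec_fun n g"
  shows "rec_fun n (\<lambda>xs. f xs * g xs)"
proof (rule rec_fun_comp2[OF _ assms])
  have "rec_fun 2 (\<lambda>xs. rec_nat 0 (\<lambda>k r. r + xs ! 0) (xs ! 1))"
    by (intro rec_fun_rec_nat rec_fun_const rec_fun_add rec_fun_nth rec_fun_nth_drop) simp_all
  moreover have "rec_nat 0 (\<lambda>k r. r + x) y = x * y" for x y :: nat by (induction y) auto
  ultimately show "rec_fun 2 (\<lambda>xs. xs ! 0 * xs ! 1)" by simp
qed

lemma rec_fun_diff: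
  assumes "rec_fun n f" "rec_fun n g"
  shows "rec_fun n (\<lambda>xs. f xs - g xs)"
proof (rule rec_fun_comp2[OF _ assms])
  have "rec_fun 1 (\<lambda>xs. rec_nat 0 (\<lambda>k r. k) (xs ! 0))"
    by (intro rec_fun_rec_nat rec_fun_const rec_fun_nth) simp_all
  moreover have "rec_nat 0 (\<lambda>k r. k) y = y - 1" for y :: nat by (induction y) auto
  ultimately have pred: "rec_fun 1 (\<lambda>xs. xs ! 0 - 1)" by simp
  have "rec_fun 2 (\<lambda>xs. rec_nat (xs ! 0) (\<lambda>k r. r - 1) (xs ! 1))"
    by (intro rec_fun_rec_nat rec_fun_comp1[OF pred] rec_fun_nth) simp_all
  moreover have "rec_nat x (\<lambda>k r. r - 1) y = x - y" for x y :: nat by (induction y) auto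
  ultimately show "rec_fun 2 (\<lambda>xs. xs ! 0 - xs ! 1)" by simp
qed

lemma rec_fun_power: "rec_fun n f \<Longrightarrow> rec_fun n (\<lambda>xs. f xs ^ e)"
  by (induction e) (auto intro: rec_fun_const rec_fun_mult)

lemma rec_fun_if_eq_0:
  assumes "rec_fun n f" "rec_fun n g" "rec_fun n h"
  shows "rec_fun n (\<lambda>xs. if f xs = 0 then g xs else h xs)"
proof -
  have "rec_fun n (\<lambda>xs. (1 - f xs) * g xs + (1 - (1 - f xs)) * h xs)"
    by (intro rec_fun_add rec_fun_mult rec_fun_diff rec_fun_const assms)
  thus ?thesis by (rule rec_fun_cong) auto
qed

text \<open>The quotient of \<open>x\<close> by \<open>Suc y\<close> is the least \<open>k\<close> with $x < (k+1)(y+1)$. Shifting the divisor by one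
keeps the search total.\<close>

lemma rec_fun_div:
  assumes "rec_fun n f" "rec_fun n g" "\<And>xs. length xs = n \<Longrightarrow> g xs > 0"
  shows "rec_fun n (\<lambda>xs. f xs div g xs)"
proof -
  let ?h = "\<lambda>k xs. Suc (xs ! 0) - Suc k * Suc (xs ! 1)"
  have least: "(LEAST k. Suc x - Suc k * Suc y = 0) = x div Suc y" for x y :: nat
  proof (rule Least_equality)
    have "x < Suc y * Suc (x div Suc y)" using dividend_less_times_div[of "Suc y" x] by simp
    thus "Suc x - Suc (x div Suc y) * Suc y = 0" by (simp add: algebra_simps)
  next
    fix k assume "Suc x - Suc k * Suc y = 0"
    hence "x < Suc k * Suc y" by simp
    hence "x div Suc y < Suc k" by (simp add: div_less_iff_less_mult)
    thus "x div Suc y \<le> k" by simp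
  qed
  have "rec_fun 2 (\<lambda>xs. LEAST k. ?h k xs = 0)"
  proof (rule rec_fun_LEAST)
    show "rec_fun (Suc 2) (\<lambda>xs. ?h (xs ! 0) (tl xs))"
      by (intro rec_fun_diff rec_fun_mult rec_fun_Suc rec_fun_nth rec_fun_nth_tl) auto
  next
    fix xs :: "nat list"
    show "\<exists>k. ?h k xs = 0" by (rule exI[of _ "xs ! 0"]) simp
  qed
  hence "rec_fun 2 (\<lambda>xs. xs ! 0 div Suc (xs ! 1))" unfolding least .
  hence "rec_fun n (\<lambda>xs. f xs div Suc (g xs - 1))"
    by (rule rec_fun_comp2[where h = "\<lambda>x y. x div Suc y"]) (intro assms rec_fun_diff rec_fun_const)+
  thus ?thesis by (rule rec_fun_cong) (use assms(3) in auto)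
qed

lemma rec_fun_prod_encode:
  assumes "rec_fun n f" "rec_fun n g"
  shows "rec_fun n (\<lambda>xs. prod_encode (f xs, g xs))"
  unfolding prod_encode_def triangle_def split_def fst_conv snd_conv
  by (intro rec_fun_add rec_fun_div rec_fun_mult rec_fun_Suc rec_fun_const assms) simp

lemma triangle_mono: "i \<le> j \<Longrightarrow> triangle i \<le> triangle j"
  by (induction rule: dec_induct) auto

text \<open>The code of \<open>(x, y)\<close> is \<open>triangle (x + y) + x\<close>, which lies below \<open>triangle (x + y + 1)\<close>. Hence
\<open>x + y\<close> can be found by a search.\<close>

lemma prod_decode_conv_LEAST:
  fixes z :: nat
  defines "s \<equiv> LEAST s. Suc z - triangle (Suc s) = 0"
  shows "prod_decode z = (z - triangle s, s - (z - triangle s))"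
proof -
  obtain x y where xy: "z = prod_encode (x, y)" by (metis prod_decode_inverse surj_pair)
  have z: "z = triangle (x + y) + x" by (simp add: xy prod_encode_def)
  have "s = x + y"
    unfolding s_def
  proof (rule Least_equality)
    fix k assume k: "Suc z - triangle (Suc k) = 0"
    show "x + y \<le> k"
    proof (rule ccontr)
      assume "\<not> x + y \<le> k"
      hence "triangle (Suc k) \<le> triangle (x + y)" by (intro triangle_mono) simp
      thus False using k z by simp
    qed
  qed (simp add: z)
  thus ?thesis unfolding xy prod_encode_inverse by (simp add: prod_encode_def)
qed

lemma rec_fun_prod_decode:
  assumes "rec_fun n f"
  shows "rec_fun n (\<lambda>xs. fst (prod_decode (f xs)))" "rec_fun n (\<lambda>xs. snd (prod_decode (f xs)))"
proof -
  have tri: "rec_fun m (\<lambda>xs. triangle (g xs))" if "rec_fun m g" for m g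
    unfolding triangle_def
    by (intro rec_fun_div rec_fun_mult rec_fun_Suc rec_fun_const that) simp
  let ?s = "\<lambda>xs. LEAST s. Suc (xs ! 0) - triangle (Suc s) = 0"
  have s: "rec_fun 1 ?s"
  proof (rule rec_fun_LEAST)
    show "rec_fun (Suc 1) (\<lambda>xs. Suc (tl xs ! 0) - triangle (Suc (xs ! 0)))"
      by (intro rec_fun_diff tri rec_fun_Suc rec_fun_nth rec_fun_nth_tl) auto
  next
    fix xs :: "nat list"
    show "\<exists>s. Suc (xs ! 0) - triangle (Suc s) = 0"
      by (rule exI[of _ "xs ! 0"]) simp
  qed
  have "rec_fun 1 (\<lambda>xs. fst (prod_decode (xs ! 0)))" "rec_fun 1 (\<lambda>xs. snd (prod_decode (xs ! 0)))"
    unfolding prod_decode_conv_LEAST fst_conv snd_conv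
    by (intro rec_fun_diff tri s rec_fun_nth; simp)+
  thus "rec_fun n (\<lambda>xs. fst (prod_decode (f xs)))" "rec_fun n (\<lambda>xs. snd (prod_decode (f xs)))"
    by (auto intro: rec_fun_comp1[where h = "\<lambda>z. fst (prod_decode z)"]
        rec_fun_comp1[where h = "\<lambda>z. snd (prod_decode z)"] assms)
qed

section \<open>Integer-valued recursive functions\<close>

text \<open>Working with the positive and the negative part makes the arithmetic operations natural-number
arithmetic. The zigzag code of an integer is needed only at the interfaces \<open>rec_int_fun_decode\<close> and
\<open>rec_fun_int_encode\<close>.\<close>

definition rec_int_fun :: "nat \<Rightarrow> (nat list \<Rightarrow> int) \<Rightarrow> bool" where
  "rec_int_fun n f \<longleftrightarrow> rec_fun n (\<lambda>xs. nat (f xs)) \<and> rec_fun n (\<lambda>xs. nat (- f xs))"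

lemma rec_int_fun_const: "rec_int_fun n (\<lambda>xs. c)"
  by (simp add: rec_int_fun_def rec_fun_const)

lemma rec_int_fun_diff:
  assumes "rec_int_fun n f" "rec_int_fun n g"
  shows "rec_int_fun n (\<lambda>xs. f xs - g xs)"
proof -
  have "rec_fun n (\<lambda>xs. (nat (f xs) + nat (- g xs)) - (nat (- f xs) + nat (g xs)))"
    "rec_fun n (\<lambda>xs. (nat (- f xs) + nat (g xs)) - (nat (f xs) + nat (- g xs)))"
    using assms unfolding rec_int_fun_def by (auto intro!: rec_fun_diff rec_fun_add)
  moreover have "(nat i + nat (- j)) - (nat (- i) + nat j) = nat (i - j)"
    "(nat (- i) + nat j) - (nat i + nat (- j)) = nat (- (i - j))" for i j by linarith+
  ultimately show ?thesis unfolding rec_int_fun_def by simp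
qed

lemma rec_int_fun_mult:
  assumes "rec_int_fun n f" "rec_int_fun n g"
  shows "rec_int_fun n (\<lambda>xs. f xs * g xs)"
proof -
  have "nat i * nat j + nat (- i) * nat (- j) = nat (i * j)"
    "nat (- i) * nat j + nat i * nat (- j) = nat (- (i * j))" for i j :: int
    by (cases i rule: int_cases2; cases j rule: int_cases2; simp flip: of_nat_mult)+
  moreover have "rec_fun n (\<lambda>xs. nat (f xs) * nat (g xs) + nat (- f xs) * nat (- g xs))"
    "rec_fun n (\<lambda>xs. nat (- f xs) * nat (g xs) + nat (f xs) * nat (- g xs))"
    using assms unfolding rec_int_fun_def by (auto intro!: rec_fun_mult rec_fun_add)
  ultimately show ?thesis unfolding rec_int_fun_def by simp
qed

lemma rec_int_fun_add:
  assumes "rec_int_fun n f" "rec_int_fun n g"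
  shows "rec_int_fun n (\<lambda>xs. f xs + g xs)"
  using rec_int_fun_diff[OF assms(1) rec_int_fun_diff[OF rec_int_fun_const[of n 0] assms(2)]] by simp

lemma rec_int_fun_power: "rec_int_fun n f \<Longrightarrow> rec_int_fun n (\<lambda>xs. f xs ^ e)"
  by (induction e) (auto intro: rec_int_fun_const rec_int_fun_mult)

lemma int_decode_conv: "int_decode n = (if even n then int (n div 2) else - int (Suc n div 2))"
  by (auto simp: int_decode_def sum_decode_def elim!: oddE)

lemma int_encode_conv: "int_encode i = (if i \<ge> 0 then 2 * nat i else 2 * nat (- i) - 1)"
  by (auto simp: int_encode_def sum_encode_def)

lemma rec_int_fun_decode:
  assumes "rec_fun n f"
  shows "rec_int_fun n (\<lambda>xs. int_decode (f xs))"
proof -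
  have "rec_fun n (\<lambda>xs. if f xs - 2 * (f xs div 2) = 0 then f xs div 2 else 0)"
    "rec_fun n (\<lambda>xs. if f xs - 2 * (f xs div 2) = 0 then 0 else Suc (f xs) div 2)"
    by (intro rec_fun_if_eq_0 rec_fun_diff rec_fun_mult rec_fun_const rec_fun_Suc rec_fun_div assms; simp)+
  moreover have "(if k - 2 * (k div 2) = 0 then k div 2 else 0) = nat (int_decode k)"
    "(if k - 2 * (k div 2) = 0 then 0 else Suc k div 2) = nat (- int_decode k)" for k
    unfolding int_decode_conv by (cases "even k"; auto elim!: evenE oddE)+
  ultimately show ?thesis unfolding rec_int_fun_def by simp
qed

lemma rec_fun_int_encode:
  assumes "rec_int_fun n f"
  shows "rec_fun n (\<lambda>xs. int_encode (f xs))"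
proof -
  have "rec_fun n (\<lambda>xs. if nat (- f xs) = 0 then 2 * nat (f xs) else 2 * nat (- f xs) - 1)"
    using assms unfolding rec_int_fun_def
    by (intro rec_fun_if_eq_0 rec_fun_diff rec_fun_mult rec_fun_const) auto
  thus ?thesis by (rule rec_fun_cong) (auto simp: int_encode_conv)
qed

section \<open>Enumerating a bounded search\<close>

text \<open>The code of the list of all \<open>h i\<close> with \<open>i < k\<close> and \<open>t i \<noteq> 0\<close>, in descending order of \<open>i\<close>, so that
each new element is put in front and one primitive recursion suffices.\<close>

fun filter_code :: "(nat \<Rightarrow> nat) \<Rightarrow> (nat \<Rightarrow> nat) \<Rightarrow> nat \<Rightarrow> nat" where
  "filter_code t h 0 = 0"
| "filter_code t h (Suc k) =
    (if t k = 0 then filter_code t h k else Suc (prod_encode (h k, filter_code t h k)))"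

lemma list_decode_filter_code:
  "list_decode (filter_code t h k) = map h (filter (\<lambda>i. t i \<noteq> 0) (rev [0..<k]))"
  by (induction k) auto

lemma rec_fun_filter_code:
  assumes t: "rec_fun 1 (\<lambda>xs. t (xs ! 0))" and h: "rec_fun 1 (\<lambda>xs. h (xs ! 0))" and f: "rec_fun n f"
  shows "rec_fun n (\<lambda>xs. filter_code t h (f xs))"
proof -
  have *: "filter_code t h k =
      rec_nat 0 (\<lambda>k r. if t k = 0 then r else Suc (prod_encode (h k, r))) k" for k
    by (induction k) auto
  show ?thesis unfolding *
    by (intro rec_fun_rec_nat rec_fun_const f rec_fun_if_eq_0 rec_fun_Suc rec_fun_prod_encode
        rec_fun_comp1[OF t] rec_fun_comp1[OF h] rec_fun_nth) auto
qed

section \<open>Small zeros of ternary quadratic forms\<close>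

definition ternary :: "int \<Rightarrow> int \<Rightarrow> int \<Rightarrow> int \<Rightarrow> int \<Rightarrow> int \<Rightarrow> int \<Rightarrow> int" where
  "ternary A B C c x y z = A * x\<^sup>2 + B * x * y + C * y\<^sup>2 - c * z\<^sup>2"

definition ternary_polar :: "int \<Rightarrow> int \<Rightarrow> int \<Rightarrow> int \<Rightarrow> int \<Rightarrow> int \<Rightarrow> int \<Rightarrow> int \<Rightarrow> int \<Rightarrow> int \<Rightarrow> int" where
  "ternary_polar A B C c x y z x' y' z' =
    2 * A * x * x' + B * (x * y' + y * x') + 2 * C * y * y' - 2 * c * z * z'"

lemma ternary_scale: "ternary A B C c (k * x) (k * y) (k * z) = k\<^sup>2 * ternary A B C c x y z"
  by (simp add: ternary_def algebra_simps power2_eq_square)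

lemma ternary_polar_scale:
  "ternary_polar A B C c x y z (k * x') (k * y') (k * z') = k * ternary_polar A B C c x y z x' y' z'"
  by (simp add: ternary_polar_def algebra_simps power2_eq_square)

text \<open>Up to the factor \<open>f\<close>, this is the reflection of the zero \<open>(x, y, z)\<close> in the hyperplane orthogonal to
\<open>(x', y', z')\<close>. Reflections preserve the quadratic form.\<close>

lemma ternary_reflect:
  fixes x y z x' y' z' :: int
  assumes "ternary A B C c x y z = 0"
  defines "f \<equiv> ternary A B C c x' y' z'" and "p \<equiv> ternary_polar A B C c x y z x' y' z'"
  shows "ternary A B C c (f * x - p * x') (f * y - p * y') (f * z - p * z') = 0"
proof -
  have "ternary A B C c (f * x - p * x') (f * y - p * y') (f * z - p * z')
      = f\<^sup>2 * ternary A B C c x y z - f * p * p + p\<^sup>2 * f"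
    unfolding f_def p_def ternary_def ternary_polar_def by algebra
  thus ?thesis using assms(1) by (simp add: power2_eq_square)
qed

text \<open>The reflected vector depends on \<open>(x', y', z')\<close> only modulo the zero \<open>(x, y, z)\<close>, up to scaling. So if
\<open>(x', y', z')\<close> is close to a multiple \<open>k / h\<close> of the zero, it can be replaced by the small difference;
this is what makes the reflected zero small.\<close>

lemma reflect_shift:
  fixes x y z x' y' z' :: int
  assumes "ternary A B C c x y z = 0"
  defines "f \<equiv> ternary A B C c x' y' z'" and "p \<equiv> ternary_polar A B C c x y z x' y' z'"
  assumes e: "e1 = h * x' - k * x" "e2 = h * y' - k * y" "e3 = h * z' - k * z"
  defines "F \<equiv> ternary A B C c e1 e2 e3" and "P \<equiv> ternary_polar A B C c x y z e1 e2 e3"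
  shows "h\<^sup>2 * (f * x - p * x') = F * x - P * e1" "h\<^sup>2 * (f * y - p * y') = F * y - P * e2"
    "h\<^sup>2 * (f * z - p * z') = F * z - P * e3"
proof -
  have F: "F = h\<^sup>2 * f - h * k * p + k\<^sup>2 * ternary A B C c x y z"
    unfolding F_def f_def p_def e ternary_def ternary_polar_def by algebra
  have P: "P = h * p - 2 * k * ternary A B C c x y z"
    unfolding P_def f_def p_def e ternary_def ternary_polar_def by algebra
  show "h\<^sup>2 * (f * x - p * x') = F * x - P * e1" "h\<^sup>2 * (f * y - p * y') = F * y - P * e2"
    "h\<^sup>2 * (f * z - p * z') = F * z - P * e3"
    unfolding F P assms(1) unfolding e by algebra+
qed

lemma abs_mult_le:
  fixes x y u v :: int
  assumes "\<bar>x\<bar> \<le> u" "\<bar>y\<bar> \<le> v" shows "\<bar>x * y\<bar> \<le> u * v"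
  unfolding abs_mult using assms by (intro mult_mono) auto

lemma abs_le_power:
  fixes T :: int
  assumes "T \<ge> 32" "\<bar>z\<bar> \<le> n * T ^ k" "n \<le> 32" "k < l"
  shows "\<bar>z\<bar> \<le> T ^ l"
proof -
  have "n * T ^ k \<le> T * T ^ k" using assms by (intro mult_right_mono) auto
  also have "\<dots> = T ^ Suc k" by simp
  also have "\<dots> \<le> T ^ l" using assms by (intro power_increasing) auto
  finally show ?thesis using assms(2) by linarith
qed

lemma abs_ternary_le:
  assumes "\<bar>A\<bar> \<le> S" "\<bar>B\<bar> \<le> S" "\<bar>C\<bar> \<le> S" "\<bar>c\<bar> \<le> S" "\<bar>x\<bar> \<le> u" "\<bar>y\<bar> \<le> u" "\<bar>z\<bar> \<le> u"
  shows "\<bar>ternary A B C c x y z\<bar> \<le> 4 * S * u\<^sup>2"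
proof -
  have "\<bar>A * (x * x)\<bar> \<le> S * (u * u)" "\<bar>B * (x * y)\<bar> \<le> S * (u * u)"
    "\<bar>C * (y * y)\<bar> \<le> S * (u * u)" "\<bar>c * (z * z)\<bar> \<le> S * (u * u)"
    by (intro abs_mult_le assms)+
  thus ?thesis unfolding ternary_def power2_eq_square mult.assoc by linarith
qed

lemma abs_ternary_polar_le:
  assumes "\<bar>A\<bar> \<le> S" "\<bar>B\<bar> \<le> S" "\<bar>C\<bar> \<le> S" "\<bar>c\<bar> \<le> S" "\<bar>x\<bar> \<le> u" "\<bar>y\<bar> \<le> u" "\<bar>z\<bar> \<le> u"
    "\<bar>x'\<bar> \<le> v" "\<bar>y'\<bar> \<le> v" "\<bar>z'\<bar> \<le> v"
  shows "\<bar>ternary_polar A B C c x y z x' y' z'\<bar> \<le> 8 * S * u * v"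
proof -
  have "\<bar>A * (x * x')\<bar> \<le> S * (u * v)" "\<bar>B * (x * y')\<bar> \<le> S * (u * v)" "\<bar>B * (y * x')\<bar> \<le> S * (u * v)"
    "\<bar>C * (y * y')\<bar> \<le> S * (u * v)" "\<bar>c * (z * z')\<bar> \<le> S * (u * v)"
    by (intro abs_mult_le assms)+
  thus ?thesis unfolding ternary_polar_def mult.assoc distrib_left by linarith
qed

text \<open>Dirichlet's pigeonhole argument: among the $N^3 + 1$ multiples of $(x, y, z)$ two lie, modulo $h$, in
the same of the $N^3$ boxes of side $h / N$.\<close>

lemma dirichlet_approx3:
  fixes x y z h N :: int
  assumes "h \<ge> 1" "N \<ge> 1"
  obtains k x' y' z' where "1 \<le> k" "k \<le> N ^ 3"
    "N * \<bar>h * x' - k * x\<bar> < h" "N * \<bar>h * y' - k * y\<bar> < h" "N * \<bar>h * z' - k * z\<bar> < h"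
proof -
  define box where "box = (\<lambda>k w. (N * ((k * w) mod h)) div h)"
  have box: "box k w \<in> {0..<N}" for k w
  proof -
    have "N * ((k * w) mod h) < N * h" using assms by (intro mult_strict_left_mono) auto
    moreover have "0 \<le> N * ((k * w) mod h)" using assms by simp
    moreover have "h * box k w \<le> N * ((k * w) mod h)"
      using assms unfolding box_def by (simp add: minus_mod_eq_mult_div [symmetric])
    ultimately have "h * box k w < h * N" by (simp add: mult.commute)
    moreover have "0 \<le> box k w"
      using \<open>0 \<le> N * ((k * w) mod h)\<close> assms unfolding box_def by (simp add: pos_imp_zdiv_nonneg_iff)
    ultimately show ?thesis using assms by simp
  qed
  let ?f = "\<lambda>k. (box k x, box k y, box k z)"
  have "\<not> inj_on ?f {0..N ^ 3}"
  proof (rule pigeonhole)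
    have "?f ` {0..N ^ 3} \<subseteq> {0..<N} \<times> {0..<N} \<times> {0..<N}" using box by auto
    hence "card (?f ` {0..N ^ 3}) \<le> card ({0..<N} \<times> {0..<N} \<times> {0..<N})" by (intro card_mono) auto
    also have "\<dots> = nat (N ^ 3)" using assms by (simp add: power3_eq_cube nat_mult_distrib)
    also have "\<dots> < card {0..N ^ 3}" using assms by simp
    finally show "card (?f ` {0..N ^ 3}) < card {0..N ^ 3}" .
  qed
  then obtain i j where ij: "i \<in> {0..N ^ 3}" "j \<in> {0..N ^ 3}" "i \<noteq> j" "?f i = ?f j"
    unfolding inj_on_def by blast
  define k l where "k = min i j" and "l = max i j"
  have kl: "0 \<le> k" "k < l" "l \<le> N ^ 3" "box k x = box l x" "box k y = box l y" "box k z = box l z"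
    using ij by (auto simp: k_def l_def min_def max_def)
  have close: "N * \<bar>h * (l * w div h - k * w div h) - (l - k) * w\<bar> < h" if "box k w = box l w" for w
  proof -
    have eq: "h * (l * w div h - k * w div h) - (l - k) * w = k * w mod h - l * w mod h"
      by (simp add: algebra_simps minus_mod_eq_mult_div [symmetric])
    have "N * (k * w mod h) - h < h * box k w" "h * box k w \<le> N * (k * w mod h)"
      "N * (l * w mod h) - h < h * box l w" "h * box l w \<le> N * (l * w mod h)"
      unfolding box_def using assms(1) 
      by (auto simp: minus_mod_eq_mult_div [symmetric])
    hence "\<bar>N * (k * w mod h) - N * (l * w mod h)\<bar> < h" using that by (auto simp: abs_if)
    thus ?thesis unfolding eq using assms(2) by (simp add: abs_mult flip: right_diff_distrib)
  qed
  show thesis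
    by (rule that[of "l - k"]) (use kl close in auto)
qed

text \<open>Cassels' theorem on small zeros, with a weaker constant. Take a zero \<open>v\<close> of minimal height \<open>h\<close> and
suppose $h > N^3$ with $N = 12 S$. An approximation \<open>b\<close> to a multiple of \<open>v\<close> with height at most $N^3$
is not a zero, by minimality, and the reflection of \<open>v\<close> in \<open>b\<close> has height at most
$12 S h / N^2 < h$, so it vanishes. But then a non-zero multiple of \<open>v\<close> is a multiple of \<open>b\<close>, and
\<open>b\<close> would be a zero after all.\<close>

lemma small_zero:
  fixes A B C c x y z S :: int
  assumes zero: "ternary A B C c x y z = 0" "(x, y, z) \<noteq> (0, 0, 0)"
    and S: "\<bar>A\<bar> \<le> S" "\<bar>B\<bar> \<le> S" "\<bar>C\<bar> \<le> S" "\<bar>c\<bar> \<le> S" "S \<ge> 1"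
  obtains x0 y0 z0 where "ternary A B C c x0 y0 z0 = 0" "(x0, y0, z0) \<noteq> (0, 0, 0)"
    "\<bar>x0\<bar> \<le> (12 * S) ^ 3" "\<bar>y0\<bar> \<le> (12 * S) ^ 3" "\<bar>z0\<bar> \<le> (12 * S) ^ 3"
proof -
  define Z where "Z = (\<lambda>(x, y, z). ternary A B C c x y z = 0 \<and> (x, y, z) \<noteq> (0, 0, 0))"
  define ht where "ht = (\<lambda>(x, y, z). nat (max \<bar>x\<bar> (max \<bar>y\<bar> \<bar>z::int\<bar>)))"
  have "Z (x, y, z)" using zero by (simp add: Z_def)
  then obtain v where v: "Z v" "\<And>w. Z w \<Longrightarrow> ht v \<le> ht w"
    using ex_has_least_nat[of Z _ ht] by blast
  obtain x0 y0 z0 where v_eq: "v = (x0, y0, z0)" by (cases v)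
  define h where "h = max \<bar>x0\<bar> (max \<bar>y0\<bar> \<bar>z0\<bar>)"
  have z0: "ternary A B C c x0 y0 z0 = 0" "(x0, y0, z0) \<noteq> (0, 0, 0)"
    using v(1) by (auto simp: Z_def v_eq)
  have le_h: "\<bar>x0\<bar> \<le> h" "\<bar>y0\<bar> \<le> h" "\<bar>z0\<bar> \<le> h" by (auto simp: h_def)
  have h1: "h \<ge> 1" using z0(2) by (auto simp: h_def)
  have min: "(a, b, d) = (0, 0, 0)"
    if "ternary A B C c a b d = 0" "\<bar>a\<bar> < h" "\<bar>b\<bar> < h" "\<bar>d\<bar> < h" for a b d
  proof (rule ccontr)
    assume "(a, b, d) \<noteq> (0, 0, 0)"
    hence "ht v \<le> ht (a, b, d)" using that(1) by (intro v(2)) (auto simp: Z_def)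
    hence "nat h \<le> nat (max \<bar>a\<bar> (max \<bar>b\<bar> \<bar>d\<bar>))" unfolding ht_def v_eq h_def by (simp only: prod.case)
    hence "h \<le> max \<bar>a\<bar> (max \<bar>b\<bar> \<bar>d\<bar>)"
      by (subst (asm) nat_le_eq_zle) (use h1 in simp_all)
    thus False using that by linarith
  qed
  \<comment> \<open>twelve is four from \<open>abs_ternary_le\<close> plus eight from \<open>abs_ternary_polar_le\<close>\<close>
  define N where "N = 12 * S"
  have N: "N \<ge> 12" using S by (simp add: N_def)
  have "h \<le> N ^ 3"
  proof (rule ccontr)
    assume "\<not> h \<le> N ^ 3"
    hence big: "N ^ 3 < h" by simp
    obtain k b1 b2 b3 where k: "1 \<le> k" "k \<le> N ^ 3" and close: "N * \<bar>h * b1 - k * x0\<bar> < h"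
      "N * \<bar>h * b2 - k * y0\<bar> < h" "N * \<bar>h * b3 - k * z0\<bar> < h"
      by (rule dirichlet_approx3[of h N x0 y0 z0]) (use h1 N in auto)
    define e1 e2 e3 where e: "e1 = h * b1 - k * x0" "e2 = h * b2 - k * y0" "e3 = h * b3 - k * z0"
    have Ne: "\<bar>N * e1\<bar> \<le> h" "\<bar>N * e2\<bar> \<le> h" "\<bar>N * e3\<bar> \<le> h"
      using close N by (auto simp: e abs_mult)
    have b_small: "\<bar>b\<bar> < h" if "N * \<bar>h * b - k * w\<bar> < h" "\<bar>w\<bar> \<le> h" for b w
    proof -
      have "1 * \<bar>h * b - k * w\<bar> \<le> N * \<bar>h * b - k * w\<bar>" using N by (intro mult_right_mono) auto
      hence "\<bar>h * b - k * w\<bar> < h" using that(1) by simp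
      moreover have "\<bar>k * w\<bar> \<le> N ^ 3 * h" using k that(2) by (intro abs_mult_le) auto
      ultimately have "\<bar>h * b\<bar> < (N ^ 3 + 1) * h" by (simp add: algebra_simps)
      hence "\<bar>b\<bar> * h < (N ^ 3 + 1) * h" using h1 by (simp add: abs_mult mult.commute)
      hence "\<bar>b\<bar> < N ^ 3 + 1" using h1 by (simp add: mult_less_cancel_right)
      thus ?thesis using big by simp
    qed
    have b_nz: "b \<noteq> 0" if "N * \<bar>h * b - k * w\<bar> < h" "\<bar>w\<bar> = h" for b w
    proof
      assume "b = 0"
      hence "N * (k * h) < h" using that k by (simp add: abs_mult)
      moreover have "1 * (1 * h) \<le> N * (k * h)" using N k h1 by (intro mult_mono) auto
      ultimately show False by simp
    qed
    have b: "\<bar>b1\<bar> < h" "\<bar>b2\<bar> < h" "\<bar>b3\<bar> < h" using b_small close le_h by blast+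
    have "\<bar>x0\<bar> = h \<or> \<bar>y0\<bar> = h \<or> \<bar>z0\<bar> = h" by (auto simp: h_def max_def)
    hence "(b1, b2, b3) \<noteq> (0, 0, 0)"
      using b_nz[OF close(1)] b_nz[OF close(2)] b_nz[OF close(3)] by blast
    hence fb: "ternary A B C c b1 b2 b3 \<noteq> 0" using min b by blast
    define f p where "f = ternary A B C c b1 b2 b3" and "p = ternary_polar A B C c x0 y0 z0 b1 b2 b3"
    define F P where "F = ternary A B C c e1 e2 e3" and "P = ternary_polar A B C c x0 y0 z0 e1 e2 e3"
    have F: "\<bar>N\<^sup>2 * F\<bar> \<le> 4 * S * h\<^sup>2"
      unfolding F_def ternary_scale[symmetric] by (intro abs_ternary_le Ne S)
    have P: "\<bar>N * P\<bar> \<le> 8 * S * h * h"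
      unfolding P_def ternary_polar_scale[symmetric] by (intro abs_ternary_polar_le Ne S le_h)
    have small: "\<bar>w\<bar> < h" if w: "h\<^sup>2 * w = F * a - P * e'" "\<bar>a\<bar> \<le> h" "\<bar>N * e'\<bar> \<le> h" for w a e'
    proof -
      have "N\<^sup>2 * (h\<^sup>2 * w) = (N\<^sup>2 * F) * a - (N * P) * (N * e')"
        unfolding w(1) by (simp add: algebra_simps power2_eq_square)
      moreover have "\<bar>(N\<^sup>2 * F) * a\<bar> \<le> 4 * S * h\<^sup>2 * h" by (intro abs_mult_le F w)
      moreover have "\<bar>(N * P) * (N * e')\<bar> \<le> 8 * S * h * h * h" by (intro abs_mult_le P w)
      ultimately have "\<bar>N\<^sup>2 * (h\<^sup>2 * w)\<bar> \<le> 12 * S * h\<^sup>2 * h"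
        unfolding power2_eq_square by linarith
      hence "(N * h\<^sup>2) * (N * \<bar>w\<bar>) \<le> (N * h\<^sup>2) * h"
        using N by (simp add: abs_mult N_def power2_eq_square mult_ac)
      moreover have "N * h\<^sup>2 > 0" using N h1 by simp
      ultimately have "N * \<bar>w\<bar> \<le> h" by (simp only: mult_le_cancel_left_pos)
      moreover have "12 * \<bar>w\<bar> \<le> N * \<bar>w\<bar>" using N by (intro mult_right_mono) auto
      ultimately show ?thesis using h1 by linarith
    qed
    note shift = reflect_shift[OF z0(1) e, folded f_def p_def F_def P_def]
    have "(f * x0 - p * b1, f * y0 - p * b2, f * z0 - p * b3) = (0, 0, 0)"
    proof (rule min)
      show "ternary A B C c (f * x0 - p * b1) (f * y0 - p * b2) (f * z0 - p * b3) = 0"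
        unfolding f_def p_def by (rule ternary_reflect[OF z0(1)])
    qed (use small shift le_h Ne in blast)+
    hence par: "f * x0 = p * b1" "f * y0 = p * b2" "f * z0 = p * b3" by auto
    have "f\<^sup>2 * ternary A B C c x0 y0 z0 = p\<^sup>2 * f"
      unfolding f_def ternary_scale[symmetric] unfolding f_def[symmetric] par ..
    hence "p = 0" using z0(1) fb by (simp add: f_def)
    hence "x0 = 0" "y0 = 0" "z0 = 0" using par fb by (auto simp: f_def)
    thus False using z0(2) by simp
  qed
  show thesis
    by (rule that[OF z0, folded N_def]; rule order_trans[OF _ \<open>h \<le> N ^ 3\<close>]; rule le_h)
qed

text \<open>The parametrisation below projects from a point with non-zero last coordinate. If the small zero
lies at infinity, reflecting it in $(1, 0, 1)$ or $(0, 1, 1)$ moves it: its last coordinate then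
becomes, up to sign, one of the two coefficients \<open>l1\<close>, \<open>l2\<close> of the tangent at the zero, and these do not both
vanish on a nondegenerate conic.\<close>

lemma small_zero_off_infinity:
  fixes A B C c x y z S :: int
  assumes zero: "ternary A B C c x y z = 0" "(x, y, z) \<noteq> (0, 0, 0)" and disc: "B\<^sup>2 \<noteq> 4 * A * C"
    and S: "\<bar>A\<bar> \<le> S" "\<bar>B\<bar> \<le> S" "\<bar>C\<bar> \<le> S" "\<bar>c\<bar> \<le> S" "S \<ge> 32"
  obtains x0 y0 z0 where "ternary A B C c x0 y0 z0 = 0" "z0 \<noteq> 0"
    "\<bar>x0\<bar> \<le> S ^ 8" "\<bar>y0\<bar> \<le> S ^ 8" "\<bar>z0\<bar> \<le> S ^ 8"
proof -
  note intro_zero = that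
  define H where "H = (12 * S) ^ 3"
  obtain x0 y0 z0 where v: "ternary A B C c x0 y0 z0 = 0" "(x0, y0, z0) \<noteq> (0, 0, 0)"
    "\<bar>x0\<bar> \<le> H" "\<bar>y0\<bar> \<le> H" "\<bar>z0\<bar> \<le> H"
    by (rule small_zero[OF zero S(1-4), folded H_def]) (use S(5) in simp)
  have S8: "13 * S * H \<le> S ^ 8"
  proof -
    have "13 * S * H = 22464 * S ^ 4" by (simp add: H_def power_mult_distrib eval_nat_numeral)
    also have "\<dots> \<le> S ^ 4 * S ^ 4"
    proof (intro mult_right_mono)
      have "(32::int) ^ 4 \<le> S ^ 4" using S by (intro power_mono) auto
      thus "22464 \<le> S ^ 4" by simp
    qed (use S in auto)
    finally show ?thesis by (simp flip: power_add)
  qed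
  have "H \<ge> 0" using S by (simp add: H_def)
  have HS: "H \<le> S * H" using mult_right_mono[of 1 S H] S \<open>H \<ge> 0\<close> by simp
  show thesis
  proof (cases "z0 = 0")
    case False
    show thesis using that[OF v(1) False] v HS S8 \<open>H \<ge> 0\<close> by linarith
  next
    case True
    define l1 l2 where "l1 = 2 * A * x0 + B * y0" and "l2 = B * x0 + 2 * C * y0"
    have *: thesis if l: "ternary_polar A B C c x0 y0 z0 x' y' 1 \<noteq> 0" and xy: "\<bar>x'\<bar> \<le> 1" "\<bar>y'\<bar> \<le> 1" for x' y'
    proof -
      let ?f = "ternary A B C c x' y' 1" and ?p = "ternary_polar A B C c x0 y0 z0 x' y' 1"
      have f: "\<bar>?f\<bar> \<le> 4 * S * 1\<^sup>2" by (intro abs_ternary_le S xy) simp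
      have p: "\<bar>?p\<bar> \<le> 8 * S * H * 1" by (intro abs_ternary_polar_le S xy v) simp
      have bd: "\<bar>?f * a - ?p * b\<bar> \<le> S ^ 8" if "\<bar>a\<bar> \<le> H" "\<bar>b\<bar> \<le> 1" for a b
      proof -
        have "\<bar>?f * a\<bar> \<le> 4 * S * 1\<^sup>2 * H" by (intro abs_mult_le f that)
        moreover have "\<bar>?p * b\<bar> \<le> 8 * S * H * 1 * 1" by (intro abs_mult_le p that)
        ultimately show ?thesis using S8 S HS \<open>H \<ge> 0\<close> by (simp add: mult.assoc)
      qed
      show thesis
        by (rule intro_zero[OF ternary_reflect[OF v(1), of x' y' 1] _ bd[OF v(3)] bd[OF v(4)] bd[OF v(5)]])
           (use True l xy in auto)
    qed
    have "l1 \<noteq> 0 \<or> l2 \<noteq> 0"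
    proof (rule ccontr)
      assume "\<not> (l1 \<noteq> 0 \<or> l2 \<noteq> 0)"
      hence l: "l1 = 0" "l2 = 0" by auto
      have "(B\<^sup>2 - 4 * A * C) * x0 = B * l2 - 2 * C * l1" "(B\<^sup>2 - 4 * A * C) * y0 = B * l1 - 2 * A * l2"
        unfolding l1_def l2_def by algebra+
      hence "x0 = 0" "y0 = 0" using l disc by auto
      thus False using v(2) True by simp
    qed
    moreover have "ternary_polar A B C c x0 y0 z0 1 0 1 = l1" "ternary_polar A B C c x0 y0 z0 0 1 1 = l2"
      by (simp_all add: True ternary_polar_def l1_def l2_def)
    ultimately show thesis using *[of 1 0] *[of 0 1] by auto
  qed
qed

section \<open>Parametrisation of a conic\<close>

definition bqf :: "'a::idom \<Rightarrow> 'a \<Rightarrow> 'a \<Rightarrow> 'a \<Rightarrow> 'a \<Rightarrow> 'a" where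
  "bqf A B C s t = A * s\<^sup>2 + B * s * t + C * t\<^sup>2"

definition bqf_polar :: "'a::idom \<Rightarrow> 'a \<Rightarrow> 'a \<Rightarrow> 'a \<Rightarrow> 'a \<Rightarrow> 'a \<Rightarrow> 'a \<Rightarrow> 'a" where
  "bqf_polar A B C x y s t = (2 * A * x + B * y) * s + (B * x + 2 * C * y) * t"

text \<open>The pair \<open>(par_x, par_y)\<close> consists of the first two coordinates of the second intersection of the
conic $A x^2 + B x y + C y^2 = c z^2$ with the line through its point $(x, y, z)$ in the direction
$(s, t, 0)$. It is the reflection of $(x, y, z)$ in $(s, t, 0)$, and its last coordinate is
\<open>bqf A B C s t * z\<close>.\<close>

definition par_x :: "'a::idom \<Rightarrow> 'a \<Rightarrow> 'a \<Rightarrow> 'a \<Rightarrow> 'a \<Rightarrow> 'a \<Rightarrow> 'a \<Rightarrow> 'a" where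
  "par_x A B C x y s t = bqf A B C s t * x - bqf_polar A B C x y s t * s"

definition par_y :: "'a::idom \<Rightarrow> 'a \<Rightarrow> 'a \<Rightarrow> 'a \<Rightarrow> 'a \<Rightarrow> 'a \<Rightarrow> 'a \<Rightarrow> 'a" where
  "par_y A B C x y s t = bqf A B C s t * y - bqf_polar A B C x y s t * t"

text \<open>The resultant of the form and of its polar at \<open>(x, y)\<close>, as an explicit combination of
the two: where both vanish, or are divisible by \<open>M\<close>, the left-hand sides are so too.\<close>

lemma bqf_polar_elim:
  "s\<^sup>2 * ((4 * A * C - B\<^sup>2) * bqf A B C x y) = (B * x + 2 * C * y)\<^sup>2 * bqf A B C s t
    - bqf_polar A B C x y s t * (B * (B * x + 2 * C * y) * s + C * bqf_polar A B C x y s t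
        - 2 * C * (2 * A * x + B * y) * s)"
  "t\<^sup>2 * ((4 * A * C - B\<^sup>2) * bqf A B C x y) = (2 * A * x + B * y)\<^sup>2 * bqf A B C s t
    - bqf_polar A B C x y s t * (B * (2 * A * x + B * y) * t + A * bqf_polar A B C x y s t
        - 2 * A * (B * x + 2 * C * y) * t)"
  unfolding bqf_def bqf_polar_def by algebra+

lemma par_common_zero:
  fixes A B C x y s t :: "'a::idom"
  assumes q: "bqf A B C x y \<noteq> 0" and disc: "B\<^sup>2 \<noteq> 4 * A * C"
    and zero: "par_x A B C x y s t = 0" "par_y A B C x y s t = 0"
  shows "s = 0 \<and> t = 0"
proof (cases "bqf_polar A B C x y s t = 0")
  case True
  hence "bqf A B C s t * x = 0" "bqf A B C s t * y = 0" using zero by (auto simp: par_x_def par_y_def)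
  hence "bqf A B C s t = 0" using q by (auto simp: bqf_def)
  hence "s\<^sup>2 * ((4 * A * C - B\<^sup>2) * bqf A B C x y) = 0" "t\<^sup>2 * ((4 * A * C - B\<^sup>2) * bqf A B C x y) = 0"
    unfolding bqf_polar_elim[where s = s and t = t] by (simp_all add: True)
  thus ?thesis using q disc by auto
next
  case False
  have "bqf_polar A B C x y s t * (x * t - y * s) = y * par_x A B C x y s t - x * par_y A B C x y s t"
    unfolding par_x_def par_y_def by algebra
  hence "x * t = y * s" using zero False by simp
  hence "x * par_x A B C x y s t = - (s\<^sup>2 * bqf A B C x y)"
    "y * par_y A B C x y s t = - (t\<^sup>2 * bqf A B C x y)"
    unfolding par_x_def par_y_def bqf_def bqf_polar_def by algebra+
  thus ?thesis using zero q by simp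
qed

text \<open>For a second zero \<open>(x, y, m)\<close> take the direction \<open>(s, t)\<close> of the line that joins it to the base point,
divided by the gcd \<open>g\<close>. The point found on this line is proportional to \<open>(x, y, m)\<close>. The
factor is \<open>M / 4\<close> with \<open>M\<close> an integer because $x^2 - D y^2 = \pm 4$ limits the common divisors of \<open>x\<close>
and \<open>y\<close>. As \<open>M\<close> divides four times the coordinates of the parametrised point, it divides multiples of
the form and of the tangent at the coprime pair \<open>(s, t)\<close>, and hence of their resultant.\<close>

lemma conic_parametrisation:
  fixes A B C c D e x y m x0 y0 m0 :: int
  assumes sol: "bqf A B C x y = c * m\<^sup>2" and norm: "x\<^sup>2 - D * y\<^sup>2 = 4 * e" "e\<^sup>2 = 1"
    and base: "bqf A B C x0 y0 = c * m0\<^sup>2" "m0 \<noteq> 0"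
    and nondeg: "c \<noteq> 0" "B\<^sup>2 \<noteq> 4 * A * C"
    and apart: "m0 * x \<noteq> m * x0 \<or> m0 * y \<noteq> m * y0"
  obtains s t M where "M \<noteq> 0" "M dvd 4 * m0 * ((4 * A * C - B\<^sup>2) * (c * m0\<^sup>2))"
    "4 * m0 * bqf A B C s t = M * m" "4 * par_x A B C x0 y0 s t = M * x" "4 * par_y A B C x0 y0 s t = M * y"
proof -
  define g where "g = gcd (m0 * x - m * x0) (m0 * y - m * y0)"
  have g: "g \<noteq> 0" using apart by (auto simp: g_def)
  obtain s t where "m0 * x - m * x0 = s * g" "m0 * y - m * y0 = t * g" and cop: "coprime s t"
    using gcd_coprime_exists[of "m0 * x - m * x0" "m0 * y - m * y0"] g unfolding g_def by auto
  hence st: "g * s = m0 * x - m * x0" "g * t = m0 * y - m * y0" by (simp_all add: mult.commute)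
  define l where "l = bqf_polar A B C x0 y0 s t"
  \<comment> \<open>reflecting the base point in \<open>m0 * (x, y, m) - m * (x0, y0, m0)\<close>, whose last coordinate is \<open>0\<close>, gives \<open>v * (x, y, m)\<close>\<close>
  define v where "v = - m0\<^sup>2 * (bqf_polar A B C x0 y0 x y - 2 * c * m0 * m)"
  have q: "bqf A B C x0 y0 \<noteq> 0" using base nondeg by auto
  have scale: "g\<^sup>2 * bqf A B C s t = bqf A B C (g * s) (g * t)"
    "g\<^sup>2 * par_x A B C x0 y0 s t = par_x A B C x0 y0 (g * s) (g * t)"
    "g\<^sup>2 * par_y A B C x0 y0 s t = par_y A B C x0 y0 (g * s) (g * t)"
    unfolding par_x_def par_y_def bqf_def bqf_polar_def by algebra+
  have X: "g\<^sup>2 * par_x A B C x0 y0 s t = v * x" and Y: "g\<^sup>2 * par_y A B C x0 y0 s t = v * y"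
    and Z: "g\<^sup>2 * (m0 * bqf A B C s t) = v * m"
    unfolding scale mult.left_commute[of "g\<^sup>2" m0] unfolding st using sol base(1)
    unfolding v_def par_x_def par_y_def bqf_def bqf_polar_def by algebra+
  \<comment> \<open>\<open>X\<close> and \<open>Y\<close> recombine to the norm of \<open>(x, y)\<close>, so \<open>M\<close> is the rational factor \<open>4 * v / g\<^sup>2\<close>\<close>
  define M where "M = e * (par_x A B C x0 y0 s t * x - D * (par_y A B C x0 y0 s t * y))"
  have "g\<^sup>2 * M = e * (v * x * x - D * (v * y * y))"
    unfolding M_def X[symmetric] Y[symmetric] by algebra
  also have "\<dots> = 4 * v" using norm by algebra
  finally have M: "g\<^sup>2 * M = 4 * v" .
  have cancel: "4 * w = M * u" if "g\<^sup>2 * w = v * u" for w u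
  proof -
    have "g\<^sup>2 * (4 * w) = g\<^sup>2 * (M * u)" using that M by algebra
    thus ?thesis using g by simp
  qed
  note X' = cancel[OF X] and Y' = cancel[OF Y] and Z' = cancel[OF Z]
  have "4 * m0 * l * s = - (M * (m0 * x - x0 * m))" "4 * m0 * l * t = - (M * (m0 * y - y0 * m))"
    using X' Y' Z' unfolding l_def par_x_def par_y_def by algebra+
  hence "M dvd (4 * m0 * l) * s" "M dvd (4 * m0 * l) * t" by simp_all
  hence "M dvd gcd ((4 * m0 * l) * s) ((4 * m0 * l) * t)" by (rule gcd_greatest)
  hence Ml: "M dvd 4 * m0 * l" using cop by (simp add: gcd_mult_left)
  have Mq: "M dvd 4 * m0 * bqf A B C s t" using Z' by (simp add: mult.assoc)
  define d where "d = 4 * m0 * ((4 * A * C - B\<^sup>2) * (c * m0\<^sup>2))"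
  have "d * s\<^sup>2 = (B * x0 + 2 * C * y0)\<^sup>2 * (4 * m0 * bqf A B C s t)
      - (4 * m0 * l) * (B * (B * x0 + 2 * C * y0) * s + C * l - 2 * C * (2 * A * x0 + B * y0) * s)"
    "d * t\<^sup>2 = (2 * A * x0 + B * y0)\<^sup>2 * (4 * m0 * bqf A B C s t)
      - (4 * m0 * l) * (B * (2 * A * x0 + B * y0) * t + A * l - 2 * A * (B * x0 + 2 * C * y0) * t)"
    using bqf_polar_elim[of s A C B x0 y0 t] bqf_polar_elim[of t A C B x0 y0 s] unfolding d_def base(1)[symmetric] l_def by algebra+
  hence "M dvd d * s\<^sup>2" "M dvd d * t\<^sup>2" using Ml Mq by (metis dvd_diff dvd_mult dvd_mult2)+
  hence "M dvd gcd (d * s\<^sup>2) (d * t\<^sup>2)" by (rule gcd_greatest)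
  hence Md: "M dvd d" using cop by (simp add: gcd_mult_left)
  have "d \<noteq> 0" using nondeg base by (simp add: d_def)
  show thesis
    by (rule that[of M s t]) (use Md \<open>d \<noteq> 0\<close> X' Y' Z' in \<open>auto simp: d_def mult.assoc\<close>)
qed

section \<open>Quartic forms that are not squares\<close>

text \<open>Completing the square, $64 c_4^3 (c_4 s^4 + c_3 s^3 + c_2 s^2 + c_1 s + c_0)$ agrees with the square
$(8 c_4^2 s^2 + 4 c_4 c_3 s + 4 c_4 c_2 - c_3^2)^2$ in degrees at least two. The defects are the
excess of the square in degree one, divided by $8 c_4$, and in degree zero. For $c_4 \neq 0$ both vanish exactly for the constant multiples of squares.\<close>

definition square_defect1 :: "'a::idom \<Rightarrow> 'a \<Rightarrow> 'a \<Rightarrow> 'a \<Rightarrow> 'a" where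
  "square_defect1 c4 c3 c2 c1 = c3 * (4 * c4 * c2 - c3\<^sup>2) - 8 * c4\<^sup>2 * c1"

definition square_defect0 :: "'a::idom \<Rightarrow> 'a \<Rightarrow> 'a \<Rightarrow> 'a \<Rightarrow> 'a" where
  "square_defect0 c4 c3 c2 c0 = (4 * c4 * c2 - c3\<^sup>2)\<^sup>2 - 64 * c4 ^ 3 * c0"

text \<open>A square has only multiple roots, so a simple root of \<open>p\<close> must occur again in \<open>q\<close>.\<close>

lemma simple_root_not_square:
  fixes p q :: "'a::idom poly"
  assumes eq: "smult k (p * q) = w\<^sup>2" "k \<noteq> 0" and root: "poly p z = 0" "poly (pderiv p) z \<noteq> 0"
  shows "poly q z = 0"
proof -
  have "(poly w z)\<^sup>2 = poly (smult k (p * q)) z" unfolding eq by simp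
  hence w: "poly w z = 0" using root by simp
  have "poly (pderiv (smult k (p * q))) z = 0"
    unfolding eq power2_eq_square by (simp add: pderiv_mult w)
  thus ?thesis using root eq(2) by (simp add: pderiv_mult pderiv_smult)
qed

lemma complete_square_quartic:
  fixes c0 c1 c2 c3 c4 :: "'a::idom"
  assumes "square_defect1 c4 c3 c2 c1 = 0" "square_defect0 c4 c3 c2 c0 = 0"
  shows "smult (64 * c4 ^ 3) [:c0, c1, c2, c3, c4:] = [:4 * c4 * c2 - c3\<^sup>2, 4 * c4 * c3, 8 * c4\<^sup>2:]\<^sup>2"
proof -
  have "64 * c4 ^ 3 * c0 = (4 * c4 * c2 - c3\<^sup>2)\<^sup>2"
    using assms(2) by (simp add: square_defect0_def)
  moreover have "64 * c4 ^ 3 * c1 = 2 * (4 * c4 * c3 * (4 * c4 * c2 - c3\<^sup>2))"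
    using assms(1) unfolding square_defect1_def by algebra
  moreover have "64 * c4 ^ 3 * c2 = (4 * c4 * c3)\<^sup>2 + 2 * (8 * c4\<^sup>2 * (4 * c4 * c2 - c3\<^sup>2))"
    "64 * c4 ^ 3 * c3 = 2 * (8 * c4\<^sup>2 * (4 * c4 * c3))" "64 * c4 ^ 3 * c4 = (8 * c4\<^sup>2)\<^sup>2"
    by algebra+
  ultimately show ?thesis by (simp add: power2_eq_square mult.commute)
qed

lemma square_defects_of_square:
  fixes b0 b1 b2 k :: "'a::idom"
  assumes "[:c0, c1, c2, c3, c4:] = smult k ([:b0, b1, b2:]\<^sup>2)"
  shows "square_defect1 c4 c3 c2 c1 = 0" "square_defect0 c4 c3 c2 c0 = 0"
proof -
  have c: "c0 = k * b0\<^sup>2" "c1 = 2 * k * b0 * b1" "c2 = k * (b1\<^sup>2 + 2 * b0 * b2)"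
    "c3 = 2 * k * b1 * b2" "c4 = k * b2\<^sup>2"
    using assms by (simp_all add: power2_eq_square algebra_simps)
  show "square_defect1 c4 c3 c2 c1 = 0" "square_defect0 c4 c3 c2 c0 = 0"
    unfolding c square_defect1_def square_defect0_def by algebra+
qed

text \<open>The coefficients \<open>u2, u1, u0\<close> and \<open>v2, v1, v0\<close> are those of \<open>par_x\<close> and \<open>par_y\<close> at the base point, so
\<open>c4, \<dots>, c0\<close> are those of the norm $R_1^2 - D R_2^2 = (R_1 + \delta R_2) (R_1 - \delta R_2)$ with
$\delta^2 = D$. The first factor has discriminant
$4 c m_0^2 (A D + C - \delta B)$, which does not vanish, so its roots are simple. If the product were
a square, such a root would be a root of the second factor, and then a common zero of $R_1$
and $R_2$. There is none.\<close>

lemma par_quartic_not_square: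
  fixes A B C c D x0 y0 m0 :: int
  assumes base: "bqf A B C x0 y0 = c * m0\<^sup>2" "m0 \<noteq> 0"
    and nondeg: "c \<noteq> 0" "B\<^sup>2 \<noteq> 4 * A * C" "A * D + C \<noteq> 0 \<or> B \<noteq> 0"
    and D: "\<not> is_square D"
  defines "u2 \<equiv> - (A * x0 + B * y0)" and "u1 \<equiv> - 2 * C * y0" and "u0 \<equiv> C * x0"
  defines "v2 \<equiv> A * y0" and "v1 \<equiv> - 2 * A * x0" and "v0 \<equiv> - (B * x0 + C * y0)"
  assumes c: "c4 = u2\<^sup>2 - D * v2\<^sup>2" "c3 = 2 * (u2 * u1 - D * (v2 * v1))"
    "c2 = u1\<^sup>2 + 2 * u2 * u0 - D * (v1\<^sup>2 + 2 * v2 * v0)" "c1 = 2 * (u1 * u0 - D * (v1 * v0))"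
    "c0 = u0\<^sup>2 - D * v0\<^sup>2"
  shows "c4 \<noteq> 0" and "square_defect1 c4 c3 c2 c1 \<noteq> 0 \<or> square_defect0 c4 c3 c2 c0 \<noteq> 0"
proof -
  have irr: "a = 0 \<and> b = 0" if "a\<^sup>2 = D * b\<^sup>2" for a b :: int
  proof (cases "b = 0")
    case False
    have "b\<^sup>2 dvd a\<^sup>2" using that by simp
    hence "b dvd a" by simp
    then obtain r where "a = b * r" by blast
    hence "D = r\<^sup>2" using that False by (simp add: power_mult_distrib)
    thus ?thesis using D by auto
  qed (use that in auto)
  have q: "bqf A B C x0 y0 \<noteq> 0" using base nondeg by auto
  show c4: "c4 \<noteq> 0"
  proof
    assume "c4 = 0"
    hence "A * x0 + B * y0 = 0" "A * y0 = 0" using irr[of u2 v2] c(1) by (auto simp: u2_def v2_def)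
    moreover have "y0 * (A * x0 + B * y0) = x0 * (A * y0) + B * y0\<^sup>2" by algebra
    ultimately show False using q nondeg(2) by (auto simp: bqf_def)
  qed
  show "square_defect1 c4 c3 c2 c1 \<noteq> 0 \<or> square_defect0 c4 c3 c2 c0 \<noteq> 0"
  proof (rule ccontr)
    assume "\<not> ?thesis"
    hence sq: "square_defect1 c4 c3 c2 c1 = 0" "square_defect0 c4 c3 c2 c0 = 0" by auto
    define \<delta> where "\<delta> = csqrt (of_int D)"
    have \<delta>: "\<delta>\<^sup>2 = of_int D" by (simp add: \<delta>_def)
    define f where "f = (\<lambda>\<epsilon>. [:of_int u0 + \<epsilon> * of_int v0, of_int u1 + \<epsilon> * of_int v1, of_int u2 + \<epsilon> * of_int v2 :: complex:])"
    define w :: "complex poly" where "w = [:of_int (4 * c4 * c2 - c3\<^sup>2), of_int (4 * c4 * c3), of_int (8 * c4\<^sup>2):]"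
    have prod: "f \<delta> * f (- \<delta>) = [:of_int c0, of_int c1, of_int c2, of_int c3, of_int c4:]"
      unfolding f_def c of_int_diff of_int_mult of_int_add of_int_power \<delta>[symmetric]
      by (simp add: algebra_simps power2_eq_square)
    have "square_defect1 (of_int c4 :: complex) (of_int c3) (of_int c2) (of_int c1)
        = of_int (square_defect1 c4 c3 c2 c1)"
      "square_defect0 (of_int c4 :: complex) (of_int c3) (of_int c2) (of_int c0)
        = of_int (square_defect0 c4 c3 c2 c0)"
      by (simp_all add: square_defect1_def square_defect0_def)
    hence "square_defect1 (of_int c4 :: complex) (of_int c3) (of_int c2) (of_int c1) = 0"
      "square_defect0 (of_int c4 :: complex) (of_int c3) (of_int c2) (of_int c0) = 0"
      using sq by simp_all
    note square = complete_square_quartic[OF this, folded prod]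
    define p0 p1 p2 where "p0 = of_int u0 + \<delta> * of_int v0" and "p1 = of_int u1 + \<delta> * of_int v1"
      and "p2 = of_int u2 + \<delta> * of_int v2"
    have p: "f \<delta> = [:p0, p1, p2:]" by (simp add: f_def p0_def p1_def p2_def)
    have "p2 * (of_int u2 - \<delta> * of_int v2) = of_int c4"
      unfolding p2_def c of_int_diff of_int_mult of_int_power \<delta>[symmetric]
      by (simp add: algebra_simps power2_eq_square)
    hence p2: "p2 \<noteq> 0" using c4 by auto
    define disc where "disc = p1\<^sup>2 - 4 * p2 * p0"
    have "disc = 4 * of_int (bqf A B C x0 y0) * (of_int (A * D + C) - \<delta> * of_int B)"
      unfolding disc_def p0_def p1_def p2_def u0_def u1_def u2_def v0_def v1_def v2_def bqf_def
        of_int_diff of_int_mult of_int_add of_int_power of_int_minus of_int_numeral \<delta>[symmetric]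
      by algebra
    moreover have "of_int (A * D + C) - \<delta> * of_int B \<noteq> 0"
    proof
      assume "of_int (A * D + C) - \<delta> * of_int B = 0"
      hence "(of_int (A * D + C))\<^sup>2 = (\<delta> * of_int B)\<^sup>2" by simp
      hence "complex_of_int ((A * D + C)\<^sup>2) = of_int (D * B\<^sup>2)" by (simp add: power_mult_distrib \<delta>)
      hence "(A * D + C)\<^sup>2 = D * B\<^sup>2" by (simp only: of_int_eq_iff)
      thus False using irr nondeg(3) by blast
    qed
    ultimately have disc: "disc \<noteq> 0" using q by simp
    define z where "z = (csqrt disc - p1) / (2 * p2)"
    have z: "2 * p2 * z + p1 = csqrt disc" using p2 by (simp add: z_def)
    have "4 * p2 * poly (f \<delta>) z = (2 * p2 * z + p1)\<^sup>2 - disc"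
      unfolding disc_def p by (simp add: algebra_simps power2_eq_square)
    hence root: "poly (f \<delta>) z = 0" using p2 by (simp add: z)
    moreover have "poly (pderiv (f \<delta>)) z = 2 * p2 * z + p1"
      unfolding p by (simp add: pderiv_pCons algebra_simps)
    hence "poly (pderiv (f \<delta>)) z \<noteq> 0" using disc by (simp add: z)
    ultimately have root': "poly (f (- \<delta>)) z = 0"
      by (intro simple_root_not_square[OF square]) (use c4 in auto)
    let ?A = "complex_of_int A" and ?B = "complex_of_int B" and ?C = "complex_of_int C"
    let ?x = "complex_of_int x0" and ?y = "complex_of_int y0"
    have f_eq: "poly (f \<epsilon>) z = par_x ?A ?B ?C ?x ?y z 1 + \<epsilon> * par_y ?A ?B ?C ?x ?y z 1" for \<epsilon>
      unfolding f_def u0_def u1_def u2_def v0_def v1_def v2_def par_x_def par_y_def bqf_def bqf_polar_def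
      by (simp add: algebra_simps power2_eq_square)
    have "\<delta> \<noteq> 0" using D \<delta> by auto
    hence "par_x ?A ?B ?C ?x ?y z 1 = 0" "par_y ?A ?B ?C ?x ?y z 1 = 0"
      using root root' unfolding f_eq by (auto simp: algebra_simps)
    moreover have "bqf ?A ?B ?C ?x ?y = of_int (bqf A B C x0 y0)" by (simp add: bqf_def)
    hence "bqf ?A ?B ?C ?x ?y \<noteq> 0" using q by simp
    moreover have "complex_of_int (B\<^sup>2) \<noteq> of_int (4 * A * C)"
      unfolding of_int_eq_iff by (rule nondeg(2))
    hence "?B\<^sup>2 \<noteq> 4 * ?A * ?C" by simp
    ultimately show False using par_common_zero[of ?A ?B ?C ?x ?y z 1] by simp
  qed
qed

section \<open>Descent from a conic to a quartic equation\<close>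

text \<open>A sufficient condition for admissibility, as the non-vanishing of a single integer polynomial, so that
a recursive function can test it by arithmetic alone.\<close>

definition thue_test :: "int \<Rightarrow> int \<Rightarrow> int \<Rightarrow> int \<Rightarrow> int \<Rightarrow> int \<Rightarrow> int" where
  "thue_test c0 c1 c2 c3 c4 d =
    c4 * d * ((square_defect1 c4 c3 c2 c1)\<^sup>2 + (square_defect0 c4 c3 c2 c0)\<^sup>2)"

lemma thue_test_nonzero_iff:
  "thue_test c0 c1 c2 c3 c4 d \<noteq> 0 \<longleftrightarrow> c4 \<noteq> 0 \<and> d \<noteq> 0 \<and>
    (square_defect1 c4 c3 c2 c1 \<noteq> 0 \<or> square_defect0 c4 c3 c2 c0 \<noteq> 0)"
  by (simp add: thue_test_def sum_power2_eq_zero_iff)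

definition quartic :: "int \<Rightarrow> int \<Rightarrow> int \<Rightarrow> int \<Rightarrow> int \<Rightarrow> int \<Rightarrow> int \<Rightarrow> int" where
  "quartic c0 c1 c2 c3 c4 s t = c4 * s ^ 4 + c3 * s ^ 3 * t + c2 * s\<^sup>2 * t\<^sup>2 + c1 * s * t ^ 3 + c0 * t ^ 4"

text \<open>The exponents are far from optimal; only their independence of the data matters. If \<open>(x, y, m)\<close> is
proportional to the base point, it determines no direction. In that case $m^2$ divides $4 m_0^2$,
so \<open>m\<close> itself is bounded, and $s^4 + t^4 = 1$ with its solution $(1, 0)$ serves as the equation.\<close>

lemma conic_descent:
  fixes A B C c D e x y m S :: int
  assumes sol: "bqf A B C x y = c * m\<^sup>2" and norm: "x\<^sup>2 - D * y\<^sup>2 = 4 * e" "e\<^sup>2 = 1"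
    and nondeg: "c \<noteq> 0" "B\<^sup>2 \<noteq> 4 * A * C" "A * D + C \<noteq> 0 \<or> B \<noteq> 0"
    and D: "\<not> is_square D"
    and S: "\<bar>A\<bar> \<le> S" "\<bar>B\<bar> \<le> S" "\<bar>C\<bar> \<le> S" "\<bar>c\<bar> \<le> S" "\<bar>D\<bar> \<le> S" "S \<ge> 32"
  obtains c0 c1 c2 c3 c4 d s t where "thue_test c0 c1 c2 c3 c4 d \<noteq> 0" "quartic c0 c1 c2 c3 c4 s t = d"
    "\<bar>c0\<bar> \<le> S ^ 60" "\<bar>c1\<bar> \<le> S ^ 60" "\<bar>c2\<bar> \<le> S ^ 60" "\<bar>c3\<bar> \<le> S ^ 60" "\<bar>c4\<bar> \<le> S ^ 60" "\<bar>d\<bar> \<le> S ^ 60"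
    "\<bar>m\<bar> \<le> S ^ 60 * (1 + \<bar>s\<bar> + \<bar>t\<bar>)\<^sup>2"
proof -
  note intro_quartic = that
  have S_pos: "S ^ k \<ge> 1" for k using S(6) by simp
  have pow: "n * S ^ k \<le> S ^ l" if "k < l" "n \<le> 32" for k l and n :: int
  proof -
    have "n * S ^ k \<le> S * S ^ k" using S(6) that S_pos[of k] by (intro mult_right_mono) auto
    also have "\<dots> = S ^ Suc k" by simp
    also have "\<dots> \<le> S ^ l" using S(6) that by (intro power_increasing) auto
    finally show ?thesis .
  qed
  have "(x, y, m) \<noteq> (0, 0, 0)" using norm by auto
  moreover have "ternary A B C c x y m = 0" using sol by (simp add: ternary_def bqf_def)
  ultimately obtain x0 y0 m0 where "ternary A B C c x0 y0 m0 = 0" and m0: "m0 \<noteq> 0"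
    and small: "\<bar>x0\<bar> \<le> S ^ 8" "\<bar>y0\<bar> \<le> S ^ 8" "\<bar>m0\<bar> \<le> S ^ 8"
    using small_zero_off_infinity[OF _ _ nondeg(2) S(1-4,6)] by metis
  hence base: "bqf A B C x0 y0 = c * m0\<^sup>2" by (simp add: ternary_def bqf_def)
  have m0sq: "\<bar>m0\<^sup>2\<bar> \<le> S ^ 16"
    using abs_mult_le[OF small(3) small(3)] by (simp add: power2_eq_square flip: power_add)
  show thesis
  proof (cases "m0 * x \<noteq> m * x0 \<or> m0 * y \<noteq> m * y0")
    case True
    obtain s t M where M: "M \<noteq> 0" "M dvd 4 * m0 * ((4 * A * C - B\<^sup>2) * (c * m0\<^sup>2))"
      and eqs: "4 * m0 * bqf A B C s t = M * m" "4 * par_x A B C x0 y0 s t = M * x"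
        "4 * par_y A B C x0 y0 s t = M * y"
      using conic_parametrisation[OF sol norm base m0 nondeg(1,2) True] by metis
    define u2 u1 u0 where "u2 = - (A * x0 + B * y0)" and "u1 = - 2 * C * y0" and "u0 = C * x0"
    define v2 v1 v0 where "v2 = A * y0" and "v1 = - 2 * A * x0" and "v0 = - (B * x0 + C * y0)"
    define c4 c3 c2 c1 c0 where c: "c4 = u2\<^sup>2 - D * v2\<^sup>2" "c3 = 2 * (u2 * u1 - D * (v2 * v1))"
      "c2 = u1\<^sup>2 + 2 * u2 * u0 - D * (v1\<^sup>2 + 2 * v2 * v0)" "c1 = 2 * (u1 * u0 - D * (v1 * v0))"
      "c0 = u0\<^sup>2 - D * v0\<^sup>2"
    define d where "d = quartic c0 c1 c2 c3 c4 s t"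
    note not_square = par_quartic_not_square[OF base m0 nondeg D, folded u2_def u1_def u0_def v2_def v1_def v0_def, OF c]
    have d_norm: "d = (par_x A B C x0 y0 s t)\<^sup>2 - D * (par_y A B C x0 y0 s t)\<^sup>2"
      unfolding d_def quartic_def c u2_def u1_def u0_def v2_def v1_def v0_def
        par_x_def par_y_def bqf_def bqf_polar_def by algebra
    have "4 * d = e * M\<^sup>2"
    proof -
      have "16 * d = (M * x)\<^sup>2 - D * (M * y)\<^sup>2" unfolding d_norm eqs[symmetric] by algebra
      also have "\<dots> = M\<^sup>2 * (x\<^sup>2 - D * y\<^sup>2)" by algebra
      finally show ?thesis unfolding norm by simp
    qed
    moreover have e: "\<bar>e\<bar> = 1" "e \<noteq> 0" using norm(2) by (auto simp: power2_eq_1_iff)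
    ultimately have d: "d \<noteq> 0" "4 * \<bar>d\<bar> = M\<^sup>2" using M(1) by (auto simp: abs_mult dest: arg_cong[of _ _ abs])
    have SS: "S * S ^ 8 = S ^ 9" "S ^ 9 * S ^ 9 = S ^ 18" "S * S ^ 18 = S ^ 19" "S * S = S ^ 2"
      "S ^ 28 * S ^ 28 = S ^ 56"
      by (simp_all add: power2_eq_square flip: power_Suc power_add)
    have lin: "\<bar>a * w\<bar> \<le> S ^ 9" if "\<bar>a\<bar> \<le> S" "\<bar>w\<bar> \<le> S ^ 8" for a w
      using abs_mult_le[OF that] by (simp only: SS)
    have uv: "\<bar>w\<bar> \<le> 2 * S ^ 9" if "w \<in> {u2, u1, u0, v2, v1, v0}" for w
      using that lin[OF S(1) small(1)] lin[OF S(2) small(1)] lin[OF S(3) small(1)]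
        lin[OF S(1) small(2)] lin[OF S(2) small(2)] lin[OF S(3) small(2)]
      unfolding u2_def u1_def u0_def v2_def v1_def v0_def by auto
    have prod: "\<bar>w * w'\<bar> \<le> 4 * S ^ 18" "\<bar>D * (w * w')\<bar> \<le> 4 * S ^ 19"
      if "w \<in> {u2, u1, u0, v2, v1, v0}" "w' \<in> {u2, u1, u0, v2, v1, v0}" for w w'
    proof -
      show *: "\<bar>w * w'\<bar> \<le> 4 * S ^ 18" using abs_mult_le[OF uv[OF that(1)] uv[OF that(2)]] SS(2) by linarith
      show "\<bar>D * (w * w')\<bar> \<le> 4 * S ^ 19" using abs_mult_le[OF S(5) *] SS(3) by linarith
    qed
    have big: "24 * S ^ 19 \<le> S ^ 60" "S ^ 18 \<le> S ^ 19" "1 \<le> S ^ 19"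
      using pow[of 19 60 24] pow[of 18 19 1] S_pos[of 19] by simp_all
    have est: "\<bar>a - b\<bar> \<le> S ^ 60" "\<bar>2 * a - 2 * b\<bar> \<le> S ^ 60"
      if "\<bar>a\<bar> \<le> 4 * S ^ 18" "\<bar>b\<bar> \<le> 4 * S ^ 19" for a b
      using that big by linarith+
    have est': "\<bar>a + 2 * a' - (b + 2 * b')\<bar> \<le> S ^ 60"
      if "\<bar>a\<bar> \<le> 4 * S ^ 18" "\<bar>b\<bar> \<le> 4 * S ^ 19" "\<bar>a'\<bar> \<le> 4 * S ^ 18" "\<bar>b'\<bar> \<le> 4 * S ^ 19"
      for a a' b b'
      using that big by linarith
    have c': "c4 = u2 * u2 - D * (v2 * v2)" "c3 = 2 * (u2 * u1) - 2 * (D * (v2 * v1))"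
      "c2 = u1 * u1 + 2 * (u2 * u0) - (D * (v1 * v1) + 2 * (D * (v2 * v0)))"
      "c1 = 2 * (u1 * u0) - 2 * (D * (v1 * v0))" "c0 = u0 * u0 - D * (v0 * v0)"
      unfolding c by algebra+
    have "\<bar>c0\<bar> \<le> S ^ 60" "\<bar>c1\<bar> \<le> S ^ 60" "\<bar>c2\<bar> \<le> S ^ 60" "\<bar>c3\<bar> \<le> S ^ 60" "\<bar>c4\<bar> \<le> S ^ 60"
      unfolding c' by - ((rule est' | rule est); (rule prod; simp))+
    moreover have "\<bar>d\<bar> \<le> S ^ 60"
    proof -
      have "\<bar>4 * A * C - B\<^sup>2\<bar> \<le> 5 * S ^ 2"
        using abs_mult_le[OF S(1) S(3)] abs_mult_le[OF S(2) S(2)] SS(4)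
        unfolding power2_eq_square mult.assoc by linarith
      hence "\<bar>m0 * ((4 * A * C - B\<^sup>2) * (c * m0\<^sup>2))\<bar> \<le> S ^ 8 * (5 * S ^ 2 * (S * S ^ 16))"
        by (intro abs_mult_le small S m0sq)
      also have "\<dots> = 5 * S ^ 27" by (simp add: mult_ac flip: power_Suc power_add)
      finally have "\<bar>4 * (m0 * ((4 * A * C - B\<^sup>2) * (c * m0\<^sup>2)))\<bar> \<le> 20 * S ^ 27"
        unfolding abs_mult[of 4] by simp
      also have "\<dots> \<le> S ^ 28" by (rule pow) auto
      finally have "\<bar>4 * m0 * ((4 * A * C - B\<^sup>2) * (c * m0\<^sup>2))\<bar> \<le> S ^ 28"
        by (simp only: mult.assoc)
      moreover have "4 * m0 * ((4 * A * C - B\<^sup>2) * (c * m0\<^sup>2)) \<noteq> 0" using m0 nondeg by simp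
      ultimately have "\<bar>M\<bar> \<le> S ^ 28" using dvd_imp_le_int[OF _ M(2)] by linarith
      hence "M\<^sup>2 \<le> S ^ 56" using abs_mult_le[of M "S ^ 28" M "S ^ 28"] SS(5) by (simp add: power2_eq_square)
      thus ?thesis using d(2) pow[of 56 60 1] by simp
    qed
    moreover have "\<bar>m\<bar> \<le> S ^ 60 * (1 + \<bar>s\<bar> + \<bar>t\<bar>)\<^sup>2"
    proof -
      define r where "r = 1 + \<bar>s\<bar> + \<bar>t\<bar>"
      have st: "\<bar>s\<bar> \<le> r" "\<bar>t\<bar> \<le> r" by (auto simp: r_def)
      have "\<bar>A * (s * s)\<bar> \<le> S * (r * r)" "\<bar>B * (s * t)\<bar> \<le> S * (r * r)" "\<bar>C * (t * t)\<bar> \<le> S * (r * r)"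
        by (intro abs_mult_le S st)+
      hence "\<bar>bqf A B C s t\<bar> \<le> 3 * (S * r\<^sup>2)" unfolding bqf_def power2_eq_square mult.assoc by linarith
      hence "\<bar>m0 * bqf A B C s t\<bar> \<le> S ^ 8 * (3 * (S * r\<^sup>2))" by (intro abs_mult_le small)
      also have "\<dots> = 3 * (S ^ 9 * r\<^sup>2)" by (simp add: mult_ac flip: power_Suc)
      finally have "\<bar>4 * (m0 * bqf A B C s t)\<bar> \<le> 12 * S ^ 9 * r\<^sup>2"
        unfolding abs_mult[of 4] by (simp add: mult.commute)
      also have "\<dots> \<le> S ^ 60 * r\<^sup>2" using pow[of 9 60 12] by (intro mult_right_mono) auto
      finally have "\<bar>M\<bar> * \<bar>m\<bar> \<le> S ^ 60 * r\<^sup>2"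
        unfolding mult.assoc[symmetric] eqs abs_mult .
      moreover have "1 * \<bar>m\<bar> \<le> \<bar>M\<bar> * \<bar>m\<bar>" using M(1) by (intro mult_right_mono) auto
      ultimately show ?thesis by (simp add: r_def)
    qed
    moreover have "thue_test c0 c1 c2 c3 c4 d \<noteq> 0"
      unfolding thue_test_nonzero_iff using not_square d(1) by blast
    ultimately show thesis by (intro intro_quartic[OF _ d_def[symmetric]]) blast+
  next
    case False
    hence "(m0 * x)\<^sup>2 - D * (m0 * y)\<^sup>2 = m\<^sup>2 * (x0\<^sup>2 - D * y0\<^sup>2)" by (simp add: algebra_simps power2_eq_square)
    moreover have "(m0 * x)\<^sup>2 - D * (m0 * y)\<^sup>2 = 4 * e * m0\<^sup>2" using norm by algebra
    ultimately have "4 * m0\<^sup>2 = m\<^sup>2 * (e * (x0\<^sup>2 - D * y0\<^sup>2))" using norm(2) by algebra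
    hence "m\<^sup>2 dvd 4 * m0\<^sup>2" by simp
    hence "m\<^sup>2 \<le> 4 * m0\<^sup>2" using m0 by (intro zdvd_imp_le) auto
    moreover have "\<bar>m\<bar> \<le> m\<^sup>2" 
      using self_le_power[of "\<bar>m\<bar>" 2] by (cases "m = 0") auto
    ultimately have "\<bar>m\<bar> \<le> S ^ 60" using m0sq pow[of 16 60 4] by simp
    hence "\<bar>m\<bar> \<le> S ^ 60 * (1 + \<bar>1\<bar> + \<bar>0\<bar>)\<^sup>2" by simp
    thus thesis
      using S_pos[of 60]
      by (intro intro_quartic[of 1 0 0 0 1 1 1 0])
         (auto simp: thue_test_nonzero_iff square_defect0_def quartic_def)
  qed
qed

section \<open>Terms of Lucas sequences as points on conics\<close>

lemma lucas_V_eq: "lucas_V P Q n = 2 * lucas_U P Q (Suc n) - P * lucas_U P Q n"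
proof (induction P Q n rule: lucas_V.induct)
  case (3 P Q n)
  show ?case unfolding lucas_V.simps(3) "3.IH" lucas_U.simps(3) by algebra
qed simp_all

lemma lucas_U_norm:
  "(lucas_U P Q (Suc n))\<^sup>2 - P * lucas_U P Q (Suc n) * lucas_U P Q n + Q * (lucas_U P Q n)\<^sup>2 = Q ^ n"
proof (induction n)
  case (Suc n)
  show ?case unfolding lucas_U.simps(3) power_Suc Suc.IH[symmetric] by algebra
qed simp

lemma lucas_V_U_norm:
  "(lucas_V P Q n)\<^sup>2 - lucas_discr P Q * (lucas_U P Q n)\<^sup>2 = 4 * Q ^ n"
  unfolding lucas_V_eq lucas_discr_def lucas_U_norm[of P Q n, symmetric] by algebra

lemma lucas_U_double:
  "lucas_U P Q (2 * k) = lucas_U P Q k * (2 * lucas_U P Q (Suc k) - P * lucas_U P Q k)"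
  "lucas_U P Q (Suc (2 * k)) = (lucas_U P Q (Suc k))\<^sup>2 - Q * (lucas_U P Q k)\<^sup>2"
proof (induction k)
  case (Suc k)
  have even: "lucas_U P Q (2 * Suc k) = P * lucas_U P Q (Suc (2 * k)) - Q * lucas_U P Q (2 * k)"
    by simp
  have odd: "lucas_U P Q (Suc (2 * Suc k)) = P * lucas_U P Q (2 * Suc k) - Q * lucas_U P Q (Suc (2 * k))"
    by simp
  show "lucas_U P Q (2 * Suc k)
      = lucas_U P Q (Suc k) * (2 * lucas_U P Q (Suc (Suc k)) - P * lucas_U P Q (Suc k))"
    unfolding even Suc.IH lucas_U.simps(3) by algebra
  show "lucas_U P Q (Suc (2 * Suc k)) = (lucas_U P Q (Suc (Suc k)))\<^sup>2 - Q * (lucas_U P Q (Suc k))\<^sup>2"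
    unfolding odd even Suc.IH lucas_U.simps(3) by algebra
qed simp_all

lemma lucas_as_form:
  fixes P Q k
  defines "D \<equiv> lucas_discr P Q" and "x \<equiv> lucas_V P Q k" and "y \<equiv> lucas_U P Q k"
  shows "4 * lucas_U P Q (2 * k) = 4 * x * y"
    "4 * lucas_U P Q (Suc (2 * k)) = x\<^sup>2 + D * y\<^sup>2 + 2 * P * x * y"
    "4 * lucas_V P Q (2 * k) = 2 * (x\<^sup>2 + D * y\<^sup>2)"
    "4 * lucas_V P Q (Suc (2 * k)) = P * (x\<^sup>2 + D * y\<^sup>2) + 2 * D * x * y"
  unfolding x_def y_def D_def lucas_V_eq lucas_U.simps(3) lucas_U_double lucas_discr_def by algebra+

text \<open>Let $n = 2 k + r$ with $r \in \{0, 1\}$ and $S_n$ the term in question. With $e = Q^k$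
one has $4 b = e b (x^2 - D y^2)$, so $4 a m^2 = 4 S_n - 4 b$ is a quadratic form in
$x, y$. Its discriminant $B^2 - 4 A C$ is a non-zero multiple of $D b^2 + 4 Q^r$ for $U$
and of $b^2 - 4 Q^r$ for $V$. The former vanishes only if $D b^2 = 4$, which makes $D$ a square,
and the latter only if $b = \pm 2$.\<close>

lemma lucas_term_conic:
  fixes a b P Q T m :: int
  assumes a: "a \<noteq> 0" and Q: "Q = 1 \<or> Q = -1" and nd: "nondegenerate P Q"
    and b: "\<not> (K = LucasV \<and> (b = 2 \<or> b = -2))"
    and T: "\<bar>a\<bar> + 32 \<le> T" "\<bar>b\<bar> + 32 \<le> T" "\<bar>P\<bar> + 32 \<le> T"
    and hit: "a * m\<^sup>2 + b = lucas K P Q n"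
  obtains A B C x y e :: int where "bqf A B C x y = (4 * a) * m\<^sup>2"
    "x\<^sup>2 - lucas_discr P Q * y\<^sup>2 = 4 * e" "e\<^sup>2 = 1"
    "B\<^sup>2 \<noteq> 4 * A * C" "A * lucas_discr P Q + C \<noteq> 0 \<or> B \<noteq> 0"
    "\<bar>A\<bar> \<le> T ^ 4" "\<bar>B\<bar> \<le> T ^ 4" "\<bar>C\<bar> \<le> T ^ 4" "\<bar>4 * a\<bar> \<le> T ^ 4" "\<bar>lucas_discr P Q\<bar> \<le> T ^ 4"
proof -
  note intro_conic = that
  define D where "D = lucas_discr P Q"
  have D: "D > 0" "\<not> is_square D" "D = P\<^sup>2 - 4 * Q"
    using nd by (auto simp: nondegenerate_def D_def lucas_discr_def)
  have T32: "T \<ge> 32" using T by linarith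
  have "\<bar>P * P\<bar> \<le> (T - 32) * (T - 32)" using T by (intro abs_mult_le) auto
  hence D_le: "\<bar>D\<bar> \<le> 1 * T ^ 2"
    using D(1,3) Q T32 by (auto simp: power2_eq_square algebra_simps)
  define k where "k = n div 2"
  define e where "e = Q ^ k"
  define x y where "x = lucas_V P Q k" and "y = lucas_U P Q k"
  have norm: "x\<^sup>2 - D * y\<^sup>2 = 4 * e" unfolding x_def y_def D_def e_def by (rule lucas_V_U_norm)
  have e: "e = 1 \<or> e = -1" using Q by (cases "even k") (auto simp: e_def)
  hence e2: "e\<^sup>2 = 1" by auto
  have b_norm: "4 * b = e * b * (x\<^sup>2 - D * y\<^sup>2)" using norm e2 by algebra
  have lin: "\<bar>u - e * b\<bar> \<le> 2 * T ^ 1" "\<bar>u + e * b\<bar> \<le> 2 * T ^ 1" if "\<bar>u\<bar> \<le> T" for u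
    using e that T by auto
  have quad: "\<bar>D * w\<bar> \<le> 2 * T ^ 3" if "\<bar>w\<bar> \<le> 2 * T ^ 1" for w
    using abs_mult_le[OF D_le that] by (simp add: eval_nat_numeral)
  note pow = abs_le_power[OF T32]
  have result: thesis if "bqf A B C x y = (4 * a) * m\<^sup>2" "B\<^sup>2 \<noteq> 4 * A * C" "A * D + C \<noteq> 0 \<or> B \<noteq> 0"
    "\<bar>A\<bar> \<le> 2 * T ^ 1" "\<bar>B\<bar> \<le> 4 * T ^ 2" "\<bar>C\<bar> \<le> 2 * T ^ 3" for A B C
  proof (rule intro_conic[of A B C x y e, folded D_def])
    have "\<bar>4 * a\<bar> \<le> 4 * T ^ 1" using T by simp
    thus "\<bar>4 * a\<bar> \<le> T ^ 4" by (rule pow) auto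
    show "\<bar>A\<bar> \<le> T ^ 4" "\<bar>B\<bar> \<le> T ^ 4" "\<bar>C\<bar> \<le> T ^ 4" "\<bar>D\<bar> \<le> T ^ 4"
      using pow[OF that(4)] pow[OF that(5)] pow[OF that(6)] pow[OF D_le] by auto
  qed (use that norm e2 in auto)
  have P_le: "\<bar>P\<bar> \<le> T" and T1: "\<bar>1\<bar> \<le> T" "\<bar>2\<bar> \<le> T" "\<bar>0\<bar> \<le> T" using T by auto
  have T2: "T * 32 \<le> T\<^sup>2" unfolding power2_eq_square using T32 by (intro mult_left_mono) auto
  have m: "(4 * a) * m\<^sup>2 = 4 * lucas K P Q n - e * b * (x\<^sup>2 - D * y\<^sup>2)"
    using hit b_norm by linarith
  have neI: "u \<noteq> v" if "u - v = w" "w \<noteq> 0" for u v w :: int using that by simp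
  note form = lucas_as_form[of P Q k, folded x_def y_def D_def]
  have n: "n = 2 * k \<or> n = Suc (2 * k)" unfolding k_def by linarith
  show thesis
  proof (cases K)
    case LucasU
    have not4: "D * b\<^sup>2 \<noteq> 4"
    proof
      assume eq: "D * b\<^sup>2 = 4"
      hence "b\<^sup>2 dvd 2\<^sup>2" by (metis dvd_triv_right power2_eq_square numeral_times_numeral semiring_norm(13,12))
      hence "b dvd 2" by (simp only: pow_divides_pow_iff)
      then obtain r where r: "2 = b * r" by blast
      hence "b\<^sup>2 * D = b\<^sup>2 * r\<^sup>2" using eq by (simp add: mult.commute flip: power_mult_distrib)
      hence "D = r\<^sup>2" using r by auto
      thus False using D(2) by auto
    qed
    have nonneg: "D * b\<^sup>2 \<ge> 0" using D(1) by simp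
    from n show thesis
    proof
      assume n: "n = 2 * k"
      show thesis
      proof (rule result[of "0 - e * b" 4 "D * (0 + e * b)"])
        show "bqf (0 - e * b) 4 (D * (0 + e * b)) x y = (4 * a) * m\<^sup>2"
          unfolding m n LucasU lucas.simps form bqf_def by algebra
        have "4\<^sup>2 - 4 * (0 - e * b) * (D * (0 + e * b)) = 16 + 4 * (D * b\<^sup>2)" using e2 by algebra
        thus "4\<^sup>2 \<noteq> 4 * (0 - e * b) * (D * (0 + e * b))" by (rule neI) (use nonneg in linarith)
        show "(0 - e * b) * D + D * (0 + e * b) \<noteq> 0 \<or> (4::int) \<noteq> 0" by simp
        show "\<bar>4\<bar> \<le> 4 * T\<^sup>2" using T2 T32 by linarith
      qed (use lin T1 quad in blast)+
    next
      assume n: "n = Suc (2 * k)"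
      show thesis
      proof (rule result[of "1 - e * b" "2 * P" "D * (1 + e * b)"])
        show "bqf (1 - e * b) (2 * P) (D * (1 + e * b)) x y = (4 * a) * m\<^sup>2"
          unfolding m n LucasU lucas.simps form bqf_def by algebra
        have "(2 * P)\<^sup>2 - 4 * (1 - e * b) * (D * (1 + e * b)) = 4 * (4 * Q + D * b\<^sup>2)"
          using e2 D(3) by algebra
        thus "(2 * P)\<^sup>2 \<noteq> 4 * (1 - e * b) * (D * (1 + e * b))" by (rule neI) (use nonneg not4 Q in auto)
        have "(1 - e * b) * D + D * (1 + e * b) = 2 * D" by algebra
        thus "(1 - e * b) * D + D * (1 + e * b) \<noteq> 0 \<or> 2 * P \<noteq> 0" using D(1) by simp
        show "\<bar>2 * P\<bar> \<le> 4 * T\<^sup>2" using P_le T2 T32 by linarith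
      qed (use lin T1 quad in blast)+
    qed
  next
    case LucasV
    hence b2: "b\<^sup>2 \<noteq> 4" using b power2_eq_iff[of b 2] by auto
    from n show thesis
    proof
      assume n: "n = 2 * k"
      show thesis
      proof (rule result[of "2 - e * b" 0 "D * (2 + e * b)"])
        show "bqf (2 - e * b) 0 (D * (2 + e * b)) x y = (4 * a) * m\<^sup>2"
          unfolding m n LucasV lucas.simps form bqf_def by algebra
        have "0\<^sup>2 - 4 * (2 - e * b) * (D * (2 + e * b)) = 4 * D * (b\<^sup>2 - 4)"
          unfolding zero_power2 using e2 by algebra
        thus "0\<^sup>2 \<noteq> 4 * (2 - e * b) * (D * (2 + e * b))" by (rule neI) (use b2 D(1) in auto)
        have "(2 - e * b) * D + D * (2 + e * b) = 4 * D" by algebra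
        thus "(2 - e * b) * D + D * (2 + e * b) \<noteq> 0 \<or> (0::int) \<noteq> 0" using D(1) by simp
        show "\<bar>0\<bar> \<le> 4 * T\<^sup>2" by simp
      qed (use lin T1 quad in blast)+
    next
      assume n: "n = Suc (2 * k)"
      show thesis
      proof (rule result[of "P - e * b" "2 * D" "D * (P + e * b)"])
        show "bqf (P - e * b) (2 * D) (D * (P + e * b)) x y = (4 * a) * m\<^sup>2"
          unfolding m n LucasV lucas.simps form bqf_def by algebra
        have bQ: "b\<^sup>2 \<noteq> 4 * Q" using b2 Q zero_le_power2[of b] by linarith
        have "(2 * D)\<^sup>2 - 4 * (P - e * b) * (D * (P + e * b)) = 4 * D * (D - P\<^sup>2 + e\<^sup>2 * b\<^sup>2)"
          by algebra
        also have "\<dots> = 4 * D * (b\<^sup>2 - 4 * Q)" using D(3) e2 by simp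
        finally show "(2 * D)\<^sup>2 \<noteq> 4 * (P - e * b) * (D * (P + e * b))"
          by (rule neI) (use D(1) bQ in simp)
        show "(P - e * b) * D + D * (P + e * b) \<noteq> 0 \<or> 2 * D \<noteq> 0" using D(1) by simp
        show "\<bar>2 * D\<bar> \<le> 4 * T\<^sup>2" using D_le by simp
      qed (use lin P_le quad in blast)+
    qed
  qed
qed

section \<open>Admissible Thue equations\<close>

definition thue_form :: "int \<Rightarrow> int \<Rightarrow> int \<Rightarrow> int \<Rightarrow> int \<Rightarrow> int poly poly" where
  "thue_form c0 c1 c2 c3 c4 = [:[:0, 0, 0, 0, c0:], [:0, 0, 0, c1:], [:0, 0, c2:], [:0, c3:], [:c4:]:]"

lemma eval2_thue_form: "eval2 (thue_form c0 c1 c2 c3 c4) s t = quartic c0 c1 c2 c3 c4 s t"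
  by (simp add: eval2_def thue_form_def quartic_def algebra_simps eval_nat_numeral)

lemma homogeneous_thue_form:
  assumes "c4 \<noteq> 0" shows "homogeneous 4 (thue_form c0 c1 c2 c3 c4)"
  using assms unfolding homogeneous_def thue_form_def
  by (auto simp: coeff_pCons split: nat.splits)

text \<open>Setting the second variable to a constant turns a possibly inhomogeneous polynomial \<open>T\<close> into an
ordinary one, and \<open>const_times_square\<close> into a statement about univariate polynomials.\<close>

lemma poly_restrict_line:
  fixes T :: "'a::comm_ring_1 poly poly"
  obtains W where "\<And>x. poly (poly T [:x:]) y = poly W x"
proof -
  have "\<exists>W. \<forall>x. poly (poly T [:x:]) y = poly W x"
  proof (induction T)
    case (pCons p T)
    then obtain W where "\<forall>x. poly (poly T [:x:]) y = poly W x" by blast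
    thus ?case by (intro exI[of _ "pCons (poly p y) W"]) simp
  qed (auto intro: exI[of _ 0])
  thus thesis using that by blast
qed

lemma thue_form_not_square:
  assumes c4: "c4 \<noteq> 0" and sq: "const_times_square (thue_form c0 c1 c2 c3 c4)"
  shows "square_defect1 c4 c3 c2 c1 = 0" "square_defect0 c4 c3 c2 c0 = 0"
proof -
  obtain \<kappa> :: complex and T where T:
    "map_poly (map_poly of_int) (thue_form c0 c1 c2 c3 c4) = smult [:\<kappa>:] (T\<^sup>2)"
    using sq unfolding const_times_square_def by blast
  obtain W where W: "\<And>x. poly (poly T [:x:]) 1 = poly W x" using poly_restrict_line[of T 1] by blast
  let ?g = "[:of_int c0, of_int c1, of_int c2, of_int c3, of_int c4 :: complex:]"
  have "poly ?g x = poly (smult \<kappa> (W\<^sup>2)) x" for x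
  proof -
    have "poly ?g x = poly (poly (map_poly (map_poly of_int) (thue_form c0 c1 c2 c3 c4)) [:x:]) 1"
      by (simp add: thue_form_def map_poly_pCons algebra_simps)
    also have "\<dots> = poly (smult \<kappa> (W\<^sup>2)) x" unfolding T by (simp add: W)
    finally show ?thesis .
  qed
  hence eq: "?g = smult \<kappa> (W\<^sup>2)" by (intro poly_eq_poly_eq_iff[THEN iffD1] ext)
  have "degree ?g = 4" using c4 by simp
  hence "degree W = 2" unfolding eq power2_eq_square
    by (cases "W = 0") (auto simp: degree_mult_eq split: if_splits)
  have "W = [:coeff W 0, coeff W 1, coeff W 2:]"
  proof (rule poly_eqI)
    fix n
    show "coeff W n = coeff [:coeff W 0, coeff W 1, coeff W 2:] n"
      using \<open>degree W = 2\<close>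
      by (cases "n > 2") (auto simp: coeff_eq_0 coeff_pCons numeral_2_eq_2 split: nat.splits)
  qed
  then obtain b0 b1 b2 where "W = [:b0, b1, b2:]" by blast
  note defects = square_defects_of_square[OF eq[unfolded this]]
  have "complex_of_int (square_defect1 c4 c3 c2 c1) = 0" "complex_of_int (square_defect0 c4 c3 c2 c0) = 0"
    using defects by (simp_all add: square_defect1_def square_defect0_def)
  thus "square_defect1 c4 c3 c2 c1 = 0" "square_defect0 c4 c3 c2 c0 = 0" by simp_all
qed

lemma thue_equation_thue_form:
  assumes "thue_test c0 c1 c2 c3 c4 d \<noteq> 0"
  shows "thue_equation (thue_form c0 c1 c2 c3 c4, d)"
proof -
  have "c4 \<noteq> 0" "d \<noteq> 0" and "\<not> const_times_square (thue_form c0 c1 c2 c3 c4)"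
    using assms thue_form_not_square unfolding thue_test_nonzero_iff by blast+
  thus ?thesis unfolding thue_equation_def
    using homogeneous_thue_form[of c4 c0 c1 c2 c3] by (auto intro!: exI[of _ 4])
qed

section \<open>The two algorithms\<close>

text \<open>A number \<open>k\<close> is read as a tuple of five coefficients and a right-hand side. The equation is assembled
from the integer codes of these six entries without decoding them; the code of the integer \<open>0\<close> is \<open>0\<close>.\<close>

definition tuple_test :: "nat \<Rightarrow> nat" where
  "tuple_test k = int_encode (case decode k of (c0, c1, c2, c3, c4, d) \<Rightarrow> thue_test c0 c1 c2 c3 c4 d)"

definition tuple_equation :: "nat \<Rightarrow> nat" where
  "tuple_equation k = (case decode k of (c0 :: nat, c1 :: nat, c2 :: nat, c3 :: nat, c4 :: nat, d :: nat) \<Rightarrow>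
    prod_encode (list_encode [list_encode [0, 0, 0, 0, c0], list_encode [0, 0, 0, c1],
      list_encode [0, 0, c2], list_encode [0, c3], list_encode [c4]], d))"

lemma decode_prod_eq: "decode n = (decode (fst (prod_decode n)), decode (snd (prod_decode n)))"
  by (simp add: decode_prod_def)

lemma decode_int_eq: "decode n = int_decode n" by (simp add: decode_int_def)
lemma decode_nat_eq: "decode n = (n::nat)" by (simp add: decode_nat_def)

lemma int_decode_0: "int_decode 0 = 0" by (simp add: int_decode_conv)

lemma int_encode_eq_0_iff: "int_encode i = 0 \<longleftrightarrow> i = 0"
  by (metis int_decode_0 int_encode_inverse int_decode_inverse)

lemma decode_tuple_equation:
  "decode (tuple_equation k) =
    (case decode k of (c0, c1, c2, c3, c4, d) \<Rightarrow> (thue_form c0 c1 c2 c3 c4, d))"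
  by (simp add: tuple_equation_def decode_prod_def decode_poly_def decode_list_def decode_int_def
      decode_nat_def thue_form_def int_decode_0 split_def del: list_encode.simps)

lemma rec_fun_tuple_test: "rec_fun 1 (\<lambda>xs. tuple_test (xs ! 0))"
  unfolding tuple_test_def decode_prod_eq decode_int_eq prod.case thue_test_def
    square_defect1_def square_defect0_def
  by (intro rec_fun_int_encode rec_int_fun_mult rec_int_fun_add rec_int_fun_diff rec_int_fun_power
      rec_int_fun_const rec_int_fun_decode rec_fun_prod_decode rec_fun_nth) simp_all

lemma rec_fun_list_encode_Nil: "rec_fun n (\<lambda>xs. list_encode [])"
  by (simp add: rec_fun_const)

lemma rec_fun_list_encode_Cons:
  "rec_fun n f \<Longrightarrow> rec_fun n (\<lambda>xs. list_encode (g xs)) \<Longrightarrow> rec_fun n (\<lambda>xs. list_encode (f xs # g xs))"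
  by (simp add: rec_fun_Suc rec_fun_prod_encode)

lemma rec_fun_tuple_equation: "rec_fun 1 (\<lambda>xs. tuple_equation (xs ! 0))"
  unfolding tuple_equation_def decode_prod_eq decode_nat_eq prod.case
  by (intro rec_fun_prod_encode rec_fun_list_encode_Cons rec_fun_list_encode_Nil rec_fun_const
      rec_fun_prod_decode rec_fun_nth) simp_all

definition tuple_bound :: "nat \<Rightarrow> nat" where
  "tuple_bound w = Suc (prod_encode (w, prod_encode (w, prod_encode (w, prod_encode (w, prod_encode (w, w))))))"

lemma prod_encode_mono: "x \<le> x' \<Longrightarrow> y \<le> y' \<Longrightarrow> prod_encode (x, y) \<le> prod_encode (x', y')"
proof -
  assume "x \<le> x'" "y \<le> y'"
  thus ?thesis by (simp add: prod_encode_def add_mono triangle_mono)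
qed

lemma int_encode_le:
  assumes "\<bar>i\<bar> \<le> int w" shows "int_encode i \<le> 2 * w"
  using assms by (auto simp: int_encode_conv)

lemma abs_le_int_encode: "\<bar>i\<bar> \<le> int (int_encode i)"
  by (auto simp: int_encode_conv)

text \<open>The factor \<open>2\<close> is the one by which the zigzag code of an integer may exceed its absolute value.\<close>

lemma encode_tuple_less:
  fixes c0 c1 c2 c3 c4 d :: int
  assumes "\<bar>c0\<bar> \<le> int w" "\<bar>c1\<bar> \<le> int w" "\<bar>c2\<bar> \<le> int w" "\<bar>c3\<bar> \<le> int w" "\<bar>c4\<bar> \<le> int w" "\<bar>d\<bar> \<le> int w"
  shows "encode (c0, c1, c2, c3, c4, d) < tuple_bound (2 * w)"
  unfolding tuple_bound_def encode_prod_def encode_int_def fst_conv snd_conv less_Suc_eq_le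
  by (intro prod_encode_mono int_encode_le assms)

lemma rec_fun_tuple_bound: "rec_fun n f \<Longrightarrow> rec_fun n (\<lambda>xs. tuple_bound (f xs))"
  unfolding tuple_bound_def by (intro rec_fun_Suc rec_fun_prod_encode)

lemma computable_of_rec_fun:
  assumes "rec_fun 1 (\<lambda>xs. h (xs ! 0))"
  shows "computable (\<lambda>x. decode (h (encode x)))"
  using assms unfolding rec_fun_def computable_def by auto

theorem theorem8:
  "reduces_to_thue
     {(a, b, P, Q, S). a \<noteq> 0 \<and> (Q = 1 \<or> Q = -1) \<and> nondegenerate P Q \<and>
        \<not> (S = LucasV \<and> (b = 2 \<or> b = -2))}
     (\<lambda>(a, b, P, Q, S). {m. a * m\<^sup>2 + b \<in> range (lucas S P Q)})"
proof -
  \<comment> \<open>240 is the product of the exponents 4 in \<open>lucas_term_conic\<close> and 60 in \<open>conic_descent\<close>\<close>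
  define W where "W = (\<lambda>n. (n + 32) ^ 240 :: nat)"
  define eqs :: "int \<times> int \<times> int \<times> int \<times> lucas_kind \<Rightarrow> (int poly poly \<times> int) list" where
    "eqs = (\<lambda>p. decode (filter_code tuple_test tuple_equation (tuple_bound (2 * W (encode p)))))"
  define cand :: "(int \<times> int \<times> int \<times> int \<times> lucas_kind) \<times> nat \<times> int \<times> int \<Rightarrow> int list" where
    "cand = (\<lambda>q. decode (filter_code (\<lambda>_. 1) (\<lambda>k. k) (Suc (2 * (W (encode q) * (encode q + 32) ^ 4)))))"
  have "computable eqs"
    unfolding eqs_def W_def
    by (intro computable_of_rec_fun rec_fun_filter_code rec_fun_tuple_test rec_fun_tuple_equation
        rec_fun_tuple_bound rec_fun_mult rec_fun_power rec_fun_add rec_fun_const rec_fun_nth) simp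
  moreover have "computable cand"
    unfolding cand_def W_def
    by (intro computable_of_rec_fun rec_fun_filter_code rec_fun_Suc
        rec_fun_mult rec_fun_power rec_fun_add rec_fun_const rec_fun_nth) simp_all
  moreover have set_eqs: "set (eqs p) = (\<lambda>(c0, c1, c2, c3, c4, d). (thue_form c0 c1 c2 c3 c4, d)) `
      decode ` {k. k < tuple_bound (2 * W (encode p)) \<and> tuple_test k \<noteq> 0}" for p
    unfolding eqs_def decode_list_def list_decode_filter_code
    by (auto simp: decode_tuple_equation image_image)
  have mem_cand: "i \<in> set (cand q)"
    if "\<bar>i\<bar> \<le> int (W (encode q) * (encode q + 32) ^ 4)" for i q
  proof -
    have "set (cand q) = int_decode ` {0..<Suc (2 * (W (encode q) * (encode q + 32) ^ 4))}"
      unfolding cand_def decode_list_def list_decode_filter_code decode_int_def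
      by (simp del: upt_Suc)
    moreover have "int_encode i \<in> {0..<Suc (2 * (W (encode q) * (encode q + 32) ^ 4))}"
      using int_encode_le[OF that] by simp
    ultimately show ?thesis by (metis imageI int_encode_inverse)
  qed
  have le_encode: "int (encode u) \<le> int (encode (u, v))" "int (encode v) \<le> int (encode (u, v))"
    for u :: "'u::coded" and v :: "'v::coded"
    by (simp_all add: encode_prod_def le_prod_encode_1 le_prod_encode_2)
  have le_encode_int: "\<bar>u\<bar> \<le> int (encode u)" for u :: int
    by (simp add: encode_int_def abs_le_int_encode)
  ultimately show ?thesis
    unfolding reduces_to_thue_def
  proof (intro exI[of _ eqs] exI[of _ cand] conjI ballI)
    fix p e assume "e \<in> set (eqs p)"
    then obtain k where k: "tuple_test k \<noteq> 0"
      "e = (case decode k of (c0, c1, c2, c3, c4, d) \<Rightarrow> (thue_form c0 c1 c2 c3 c4, d))"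
      unfolding set_eqs by blast
    obtain c0 c1 c2 c3 c4 d :: int where "decode k = (c0, c1, c2, c3, c4, d)" by (rule prod_cases6)
    hence test: "thue_test c0 c1 c2 c3 c4 d \<noteq> 0" and e: "e = (thue_form c0 c1 c2 c3 c4, d)"
      using k by (auto simp: tuple_test_def int_encode_eq_0_iff)
    show "thue_equation e" unfolding e using test by (rule thue_equation_thue_form)
  next
    fix p m
    assume p: "p \<in> {(a, b, P, Q, S). a \<noteq> 0 \<and> (Q = 1 \<or> Q = -1) \<and> nondegenerate P Q \<and>
        \<not> (S = LucasV \<and> (b = 2 \<or> b = -2))}"
      and m: "m \<in> (case p of (a, b, P, Q, S) \<Rightarrow> {m. a * m\<^sup>2 + b \<in> range (lucas S P Q)})"
    obtain a b P Q K where p_eq: "p = (a, b, P, Q, K)" by (cases p)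
    have I: "a \<noteq> 0" "Q = 1 \<or> Q = -1" "nondegenerate P Q" "\<not> (K = LucasV \<and> (b = 2 \<or> b = -2))"
      using p by (auto simp: p_eq)
    obtain n where hit: "a * m\<^sup>2 + b = lucas K P Q n" using m by (auto simp: p_eq)
    define T where "T = int (encode p) + 32"
    have T: "\<bar>a\<bar> + 32 \<le> T" "\<bar>b\<bar> + 32 \<le> T" "\<bar>P\<bar> + 32 \<le> T"
      unfolding T_def p_eq
      using le_encode(1)[of a "(b, P, Q, K)"] le_encode(2)[of "(b, P, Q, K)" a]
        le_encode(1)[of b "(P, Q, K)"] le_encode(2)[of "(P, Q, K)" b] le_encode(1)[of P "(Q, K)"]
        le_encode_int[of a] le_encode_int[of b] le_encode_int[of P] by linarith+
    obtain A B C x y e where conic: "bqf A B C x y = (4 * a) * m\<^sup>2"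
      "x\<^sup>2 - lucas_discr P Q * y\<^sup>2 = 4 * e" "e\<^sup>2 = 1"
      "B\<^sup>2 \<noteq> 4 * A * C" "A * lucas_discr P Q + C \<noteq> 0 \<or> B \<noteq> 0"
      "\<bar>A\<bar> \<le> T ^ 4" "\<bar>B\<bar> \<le> T ^ 4" "\<bar>C\<bar> \<le> T ^ 4" "\<bar>4 * a\<bar> \<le> T ^ 4" "\<bar>lucas_discr P Q\<bar> \<le> T ^ 4"
      using lucas_term_conic[OF I T hit] by blast
    have "T ^ 1 \<le> T ^ 4" unfolding T_def by (rule power_increasing) auto
    hence "T ^ 4 \<ge> 32" by (simp add: T_def)
    moreover have "\<not> is_square (lucas_discr P Q)" "4 * a \<noteq> 0" using I by (auto simp: nondegenerate_def)
    ultimately obtain c0 c1 c2 c3 c4 d s t where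
      test: "thue_test c0 c1 c2 c3 c4 d \<noteq> 0" and sol: "quartic c0 c1 c2 c3 c4 s t = d"
      and small: "\<bar>c0\<bar> \<le> (T ^ 4) ^ 60" "\<bar>c1\<bar> \<le> (T ^ 4) ^ 60" "\<bar>c2\<bar> \<le> (T ^ 4) ^ 60"
        "\<bar>c3\<bar> \<le> (T ^ 4) ^ 60" "\<bar>c4\<bar> \<le> (T ^ 4) ^ 60" "\<bar>d\<bar> \<le> (T ^ 4) ^ 60"
      and m_le: "\<bar>m\<bar> \<le> (T ^ 4) ^ 60 * (1 + \<bar>s\<bar> + \<bar>t\<bar>)\<^sup>2"
      using conic_descent[OF conic(1-3) _ conic(4-5) _ conic(6-10)] by blast
    have W: "(T ^ 4) ^ 60 = int (W (encode p))" by (simp add: T_def W_def flip: power_mult)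
    have "encode (c0, c1, c2, c3, c4, d) < tuple_bound (2 * W (encode p))"
      by (intro encode_tuple_less small[unfolded W])
    moreover have "tuple_test (encode (c0, c1, c2, c3, c4, d)) \<noteq> 0"
      using test by (simp add: tuple_test_def decode_encode int_encode_eq_0_iff)
    ultimately have "(thue_form c0 c1 c2 c3 c4, d) \<in> set (eqs p)"
      unfolding set_eqs by (force simp: decode_encode)
    then obtain i where i: "i < length (eqs p)" "eqs p ! i = (thue_form c0 c1 c2 c3 c4, d)"
      by (auto simp: in_set_conv_nth)
    define q where "q = (p, i, s, t)"
    define N where "N = int (encode q)"
    have "int (encode p) \<le> N" and st: "\<bar>s\<bar> \<le> N" "\<bar>t\<bar> \<le> N"
      using le_encode(1)[of p "(i, s, t)"] le_encode(2)[of "(i, s, t)" p] le_encode(2)[of "(s, t)" i]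
        le_encode(1)[of s t] le_encode(2)[of t s] le_encode_int[of s] le_encode_int[of t] unfolding N_def q_def by linarith+
    hence "(T ^ 4) ^ 60 \<le> int (W (encode q))"
      unfolding W by (simp add: W_def N_def power_mono)
    moreover have "(1 + \<bar>s\<bar> + \<bar>t\<bar>)\<^sup>2 \<le> (N + 32) ^ 4"
    proof -
      have "1 + \<bar>s\<bar> + \<bar>t\<bar> \<le> 2 * (N + 32)" using st by simp
      also have "\<dots> \<le> (N + 32) * (N + 32)" unfolding N_def by (intro mult_right_mono) auto
      finally have "(1 + \<bar>s\<bar> + \<bar>t\<bar>)\<^sup>2 \<le> ((N + 32)\<^sup>2)\<^sup>2"
        unfolding power2_eq_square[of "N + 32"] by (intro power_mono) auto
      thus ?thesis by (simp flip: power_mult)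
    qed
    ultimately have "(T ^ 4) ^ 60 * (1 + \<bar>s\<bar> + \<bar>t\<bar>)\<^sup>2 \<le> int (W (encode q)) * (N + 32) ^ 4"
      by (intro mult_mono) auto
    hence "\<bar>m\<bar> \<le> int (W (encode q) * (encode q + 32) ^ 4)" using m_le by (simp add: N_def)
    hence "m \<in> set (cand (p, i, (s, t)))" unfolding q_def by (rule mem_cand)
    moreover have "solves (s, t) (eqs p ! i)"
      unfolding i(2) by (simp add: solves_def eval2_thue_form sol)
    ultimately show "\<exists>i<length (eqs p). \<exists>z. solves z (eqs p ! i) \<and> m \<in> set (cand (p, i, z))"
      using i(1) by blast
  qed auto
qed

end
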